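(* Let $V$ be a Euclidean Jordan algebra with unit $e$, let $K=V_+$ be its symmetric cone, and let $T$ be a linear transformation on $V$ with $T(K)\subseteq K$. Then the following are equivalent: (i) For every idempotent $c\in V$: $\langle T(c),e-c\rangle=0\Rightarrow c=0$ or $c=e$. (ii) $T$ is space-irreducible, that is, for every idempotent $c\in V$: $T(V(c,1))\subseteq V(c,1)\Rightarrow c=0$ or $c=e$. (iii) $T$ is $K$-irreducible. (iv) For each $0\neq x\ge 0$, it holds that $(I+T)^{n-1}x>0$, where $n$ denotes the rank of $V$. (v) For each $0\neq x\ge 0$ and every $t>0$, $\exp(tT)x>0$.
   Context: A Euclidean Jordan algebra $(V,\circ,\langle\cdot,\cdot\rangle)$ is a finite dimensional real inner product space with a commutative bilinear product $\circ$ and unit element $e$ satisfying $x\circ(x^2\circ y)=x^2\circ(x\circ y)$ and $\langle x\circ y,z\rangle=\langle y,x\circ z\rangle$, where $x^2=x\circ x$. An element $c$ is an idempotent if $c^2=c$; it is primitive if it is nonzero and is not a sum of two nonzero idempotents. A Jordan frame is a set of mutually orthogonal primitive idempotents with sum $e$; all Jordan frames have the same number $n$ of elements, called the rank of $V$. Every $x\in V$ has a spectral decomposition $x=x_1e_1+\cdots+x_ne_n$ with $\{e_1,\dots,e_n\}$ a Jordan frame and $x_i\in\mathbb{R}$; $\operatorname{tr}(x)=x_1+\cdots+x_n$. The inner product is assumed to be the trace inner product $\langle x,y\rangle=\operatorname{tr}(x\circ y)$. The symmetric cone is $K=V_+=\{x\circ x:x\in V\}$; $x\ge 0$ means $x\in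 K$ and $x>0$ means $x$ is in the interior of $K$. For an idempotent $c$, $V(c,1)=\{x\in V:x\circ c=x\}$. A face of $K$ is a convex cone $F\subseteq K$ such that if $a\in F$ and $a=b+d$ with $b,d\in K$, then $b,d\in F$. A linear $T$ with $T(K)\subseteq K$ is $K$-irreducible if the only faces of $K$ invariant under $T$ are $\{0\}$ and $K$. $I$ is the identity and $\exp(T)=\sum_{k\ge 0}T^k/k!$. *)

theory Defs
  imports "HOL-Analysis.Analysis"
begin

text \<open>
  The carrier is a type of class \<open>euclidean_space\<close>, i.e. an arbitrary nonzero finite-dimensional
  real inner product space; the Jordan product and the unit are explicit parameters.
\<close>

locale euclidean_jordan_algebra =
  fixes jp :: "'a::euclidean_space \<Rightarrow> 'a \<Rightarrow> 'a"  (infixl "\<circ>\<^sub>J" 70)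
    and e :: 'a
  assumes bilinear: "bilinear (\<circ>\<^sub>J)"
    and commute: "x \<circ>\<^sub>J y = y \<circ>\<^sub>J x"
    and unit: "e \<circ>\<^sub>J x = x"
    and jordan_identity: "x \<circ>\<^sub>J ((x \<circ>\<^sub>J x) \<circ>\<^sub>J y) = (x \<circ>\<^sub>J x) \<circ>\<^sub>J (x \<circ>\<^sub>J y)"
    and inner_assoc: "inner (x \<circ>\<^sub>J y) z = inner y (x \<circ>\<^sub>J z)"

definition idempotent :: "('a \<Rightarrow> 'a \<Rightarrow> 'a) \<Rightarrow> 'a \<Rightarrow> bool" where
  "idempotent jp c \<longleftrightarrow> jp c c = c"

definition primitive_idempotent :: "('a::euclidean_space \<Rightarrow> 'a \<Rightarrow> 'a) \<Rightarrow> 'a \<Rightarrow> bool" where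
  "primitive_idempotent jp c \<longleftrightarrow> idempotent jp c \<and> c \<noteq> 0 \<and>
     \<not> (\<exists>a b. idempotent jp a \<and> idempotent jp b \<and> a \<noteq> 0 \<and> b \<noteq> 0 \<and> c = a + b)"

text \<open>
  Orthogonality of idempotents is \<open>c \<circ> d = 0\<close>. Finiteness is automatic mathematically, but is
  needed for the sum to be meaningful.
\<close>

definition jordan_frame :: "('a::euclidean_space \<Rightarrow> 'a \<Rightarrow> 'a) \<Rightarrow> 'a \<Rightarrow> 'a set \<Rightarrow> bool" where
  "jordan_frame jp e E \<longleftrightarrow> finite E \<and> (\<forall>c\<in>E. primitive_idempotent jp c) \<and>
     (\<forall>c\<in>E. \<forall>d\<in>E. c \<noteq> d \<longrightarrow> jp c d = 0) \<and> (\<Sum>c\<in>E. c) = e"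

text \<open>
  Rank and trace are read off from an arbitrarily chosen Jordan frame, respectively spectral
  decomposition. In a Euclidean Jordan algebra these always exist, and neither value depends on
  the choice.
\<close>

definition jordan_rank :: "('a::euclidean_space \<Rightarrow> 'a \<Rightarrow> 'a) \<Rightarrow> 'a \<Rightarrow> nat" where
  "jordan_rank jp e = card (SOME E. jordan_frame jp e E)"

definition spectral_decomposition ::
    "('a::euclidean_space \<Rightarrow> 'a \<Rightarrow> 'a) \<Rightarrow> 'a \<Rightarrow> 'a \<Rightarrow> 'a set \<Rightarrow> ('a \<Rightarrow> real) \<Rightarrow> bool" where
  "spectral_decomposition jp e x E l \<longleftrightarrow> jordan_frame jp e E \<and> x = (\<Sum>c\<in>E. l c *\<^sub>R c)"

definition jordan_trace :: "('a::euclidean_space \<Rightarrow> 'a \<Rightarrow> 'a) \<Rightarrow> 'a \<Rightarrow> 'a \<Rightarrow> real" where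
  "jordan_trace jp e x =
     (SOME t. \<exists>E l. spectral_decomposition jp e x E l \<and> t = (\<Sum>c\<in>E. l c))"

locale trace_euclidean_jordan_algebra = euclidean_jordan_algebra +
  assumes inner_eq_trace: "inner x y = jordan_trace (\<circ>\<^sub>J) e (x \<circ>\<^sub>J y)"

definition symmetric_cone :: "('a \<Rightarrow> 'a \<Rightarrow> 'a) \<Rightarrow> 'a set" where
  "symmetric_cone jp = range (\<lambda>x. jp x x)"

definition peirce_one :: "('a \<Rightarrow> 'a \<Rightarrow> 'a) \<Rightarrow> 'a \<Rightarrow> 'a set" where
  "peirce_one jp c = {x. jp x c = x}"

text \<open>
  The library's \<open>convex_cone\<close> is nonempty by definition, so the empty set does not count as a face.
\<close>

definition cone_face :: "'a::euclidean_space set \<Rightarrow> 'a set \<Rightarrow> bool" where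
  "cone_face K F \<longleftrightarrow> convex_cone F \<and> F \<subseteq> K \<and>
     (\<forall>b\<in>K. \<forall>d\<in>K. b + d \<in> F \<longrightarrow> b \<in> F \<and> d \<in> F)"

definition cone_irreducible :: "'a::euclidean_space set \<Rightarrow> ('a \<Rightarrow> 'a) \<Rightarrow> bool" where
  "cone_irreducible K T \<longleftrightarrow> (\<forall>F. cone_face K F \<and> T ` F \<subseteq> F \<longrightarrow> F = {0} \<or> F = K)"

definition space_irreducible ::
    "('a::euclidean_space \<Rightarrow> 'a \<Rightarrow> 'a) \<Rightarrow> 'a \<Rightarrow> ('a \<Rightarrow> 'a) \<Rightarrow> bool" where
  "space_irreducible jp e T \<longleftrightarrow>
     (\<forall>c. idempotent jp c \<and> T ` peirce_one jp c \<subseteq> peirce_one jp c \<longrightarrow> c = 0 \<or> c = e)"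

text \<open>
  The exponential series is taken pointwise; in finite dimension this agrees with convergence
  in operator norm.
\<close>

definition exp_map :: "('a::euclidean_space \<Rightarrow> 'a) \<Rightarrow> 'a \<Rightarrow> 'a" where
  "exp_map T x = (\<Sum>k. (T ^^ k) x /\<^sub>R fact k)"

end

theory Submission
  imports Defs
begin

text \<open>
  Write \<open>L(x)\<close> for multiplication by \<open>x\<close>, \<open>x \<le> y\<close> for \<open>y - x \<in> K\<close> and (i) for the condition on the
  numbers \<open>\<langle>T c, e - c\<rangle>\<close>. Everything follows from a dictionary between the cone and the idempotents.

  The linearised Jordan identity shows that all \<open>L(x\<^sup>n)\<close> commute, so the powers of \<open>x\<close> span an
  associative algebra of self-adjoint multiplications, and such an algebra is spanned by orthogonal
  idempotents (\<open>associative_subalgebra_spanned_by_idempotents\<close>); this is the spectral theorem. For an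
  idempotent \<open>c\<close> the operator \<open>L(c)\<close> is positive semidefinite, and therefore \<open>x \<in> K\<close> exactly when
  \<open>L(x)\<close> is (\<open>symmetric_cone_iff_psd\<close>). This makes \<open>K\<close> a closed self-dual cone in which
  \<open>\<langle>x, c\<rangle> = 0\<close> forces \<open>x \<circ> c = 0\<close>. Every \<open>x \<in> K\<close> has a support, an idempotent \<open>c\<close> with
  \<open>a c \<le> x \<le> b c\<close> for some positive \<open>a\<close> and \<open>b\<close>; the point \<open>x\<close> is interior exactly when its
  support is \<open>e\<close>, and the faces of \<open>K\<close> are the sets \<open>K \<inter> V(c,1)\<close>.

  Since \<open>T\<close> preserves \<open>K\<close>, the number \<open>\<langle>T c, e - c\<rangle>\<close> vanishes exactly when \<open>T\<close> maps \<open>V(c,1)\<close> into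
  itself, and exactly when \<open>T\<close> maps the face of \<open>c\<close> into itself. Hence (i), space-irreducibility and
  cone-irreducibility say the same thing. Moreover, such an invariant \<open>V(c,1)\<close> with \<open>c \<noteq> 0\<close> contains
  \<open>(I + T)\<^sup>m c\<close> and \<open>exp(t T) c\<close>; if one of them is interior then \<open>c = e\<close>. So positivity of the power,
  or of the exponential at a single time, implies (i).

  Conversely, assume (i). The supports of \<open>(I + T)\<^sup>k x\<close> increase with \<open>k\<close>. Two consecutive supports can
  coincide only in an idempotent \<open>c\<close> with \<open>\<langle>T c, e - c\<rangle> = 0\<close>, hence, being nonzero, only in \<open>e\<close>. The trace inner
  product gives every primitive idempotent norm one, so the squared norm of an idempotent is a natural
  number, that of \<open>e\<close> is the rank \<open>n\<close>, and each strict increase of the support costs at least one. The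
  support is therefore \<open>e\<close> after \<open>n - 1\<close> steps. Finally, if \<open>u = exp(t T) x\<close> has support \<open>c\<close>, all
  terms of the exponential series lie in \<open>K\<close> and hence in \<open>V(c,1)\<close>, so \<open>(I + T)\<^sup>m x \<in> V(c,1)\<close> for every
  \<open>m\<close>; when one of these is interior, \<open>c = e\<close>.
\<close>

section \<open>Positive semidefinite operators\<close>

text \<open>
  Perturbing a zero \<open>w\<close> of the form in the direction \<open>B w\<close> changes it to first order by
  \<open>2 s \<langle>B w, B w\<rangle>\<close>, which would make the form negative for small \<open>s < 0\<close> unless \<open>B w = 0\<close>.
\<close>

lemma psd_form_zero_imp_kernel:
  fixes B :: "'b::real_inner \<Rightarrow> 'b"
  assumes lin: "linear B" and sub: "subspace S" and inv: "\<And>v. v \<in> S \<Longrightarrow> B v \<in> S"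
    and sym: "\<And>u v. u \<in> S \<Longrightarrow> v \<in> S \<Longrightarrow> inner (B u) v = inner u (B v)"
    and psd: "\<And>v. v \<in> S \<Longrightarrow> inner (B v) v \<ge> 0"
    and w: "w \<in> S" and zero: "inner (B w) w = 0"
  shows "B w = 0"
proof -
  define p q where "p = inner (B w) (B w)" and "q = inner (B (B w)) (B w)"
  have q: "q \<ge> 0" unfolding q_def using psd inv w by blast
  have form: "0 \<le> 2 * s * p + s\<^sup>2 * q" for s
  proof -
    have "w + s *\<^sub>R B w \<in> S" using sub w inv by (simp add: subspace_add subspace_scale)
    then have "0 \<le> inner (B (w + s *\<^sub>R B w)) (w + s *\<^sub>R B w)" by (rule psd)
    also have "\<dots> = s * inner (B w) (B w) + s * inner (B (B w)) w + s\<^sup>2 * q"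
      using zero by (simp add: linear_add[OF lin] linear_scale[OF lin] inner_add_left
          inner_add_right q_def power2_eq_square algebra_simps)
    also have "inner (B (B w)) w = p" unfolding p_def using sym[of "B w" w] inv w by simp
    finally show ?thesis by (simp add: p_def)
  qed
  \<comment> \<open>\<open>s = - p / (q + 1)\<close> nearly minimises the quadratic; the \<open>+ 1\<close> covers the case \<open>q = 0\<close>.\<close>
  have "0 \<le> - (2 * p\<^sup>2 / (q + 1)) + p\<^sup>2 * q / (q + 1)\<^sup>2"
    using form[of "- (p / (q + 1))"] by (simp add: power2_eq_square)
  also have "\<dots> = - (p\<^sup>2 * (q + 2) / (q + 1)\<^sup>2)"
    using q by (simp add: divide_simps power2_eq_square) (simp add: algebra_simps)
  finally have "p\<^sup>2 * (q + 2) / (q + 1)\<^sup>2 \<le> 0" by simp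
  then have "p = 0" using q by (simp add: divide_le_0_iff mult_le_0_iff)
  then show ?thesis unfolding p_def by simp
qed

text \<open>
  At a maximum \<open>w\<close> of the Rayleigh quotient on the unit sphere of \<open>S\<close>, with maximal value \<open>l\<close>, the
  operator \<open>l - f\<close> is positive semidefinite on \<open>S\<close> and its form vanishes at \<open>w\<close>.
\<close>

lemma self_adjoint_has_eigenvector:
  fixes f :: "'b::euclidean_space \<Rightarrow> 'b"
  assumes lin: "linear f" and sub: "subspace S" and inv: "\<And>v. v \<in> S \<Longrightarrow> f v \<in> S"
    and sym: "\<And>u v. u \<in> S \<Longrightarrow> v \<in> S \<Longrightarrow> inner (f u) v = inner u (f v)"
    and nz: "S \<noteq> {0}"
  shows "\<exists>w l. w \<in> S \<and> w \<noteq> 0 \<and> f w = l *\<^sub>R w"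
proof -
  obtain v where v: "v \<in> S" "v \<noteq> 0" using nz subspace_0[OF sub] by blast
  have "compact (sphere 0 1 \<inter> S)" by (intro compact_Int_closed compact_sphere closed_subspace sub)
  moreover have "(1 / norm v) *\<^sub>R v \<in> sphere 0 1 \<inter> S"
    using v sub by (simp add: subspace_scale)
  moreover have "continuous_on (sphere 0 1 \<inter> S) (\<lambda>w. inner (f w) w)"
    by (intro continuous_intros linear_continuous_on linear_linear[THEN iffD2] lin)
  ultimately obtain w where w: "norm w = 1" "w \<in> S"
    and max: "\<And>u. norm u = 1 \<Longrightarrow> u \<in> S \<Longrightarrow> inner (f u) u \<le> inner (f w) w"
    using continuous_attains_sup[of "sphere 0 1 \<inter> S" "\<lambda>w. inner (f w) w"]
    by (metis (no_types, lifting) IntE IntI empty_iff mem_sphere_0)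
  define l where "l = inner (f w) w"
  have "l *\<^sub>R w - f w = 0"
  proof (rule psd_form_zero_imp_kernel[where B = "\<lambda>v. l *\<^sub>R v - f v" and S = S])
    show "linear (\<lambda>v. l *\<^sub>R v - f v)" by (intro linear_compose_sub linear_scale_self lin)
    show "0 \<le> inner (l *\<^sub>R u - f u) u" if "u \<in> S" for u
    proof (cases "u = 0")
      case False
      have "inner (f ((1 / norm u) *\<^sub>R u)) ((1 / norm u) *\<^sub>R u) \<le> l"
        unfolding l_def using False that sub by (intro max) (auto simp: subspace_scale)
      then have "inner (f u) u / (norm u)\<^sup>2 \<le> l"
        by (simp add: linear_scale[OF lin] power2_eq_square)
      then have "inner (f u) u \<le> l * inner u u"
        using False by (simp add: divide_le_eq dot_square_norm)
      then show ?thesis by (simp add: inner_diff_left)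
    qed simp
  qed (use w inv sym sub in \<open>auto simp: l_def subspace_diff subspace_scale inner_diff_left
      inner_diff_right dot_square_norm\<close>)
  then show ?thesis using w by (intro exI[of _ w] exI[of _ l]) auto
qed

section \<open>Linearised Jordan identities\<close>

context euclidean_jordan_algebra
begin

lemma jp_linear: "linear (\<lambda>y. x \<circ>\<^sub>J y)" and jp_linear_left: "linear (\<lambda>x. x \<circ>\<^sub>J y)"
  using bilinear unfolding bilinear_def by auto

lemmas jp_simps =
  bilinear_ladd[OF bilinear] bilinear_radd[OF bilinear] bilinear_lsub[OF bilinear]
  bilinear_rsub[OF bilinear] bilinear_lmul[OF bilinear] bilinear_rmul[OF bilinear]
  bilinear_lneg[OF bilinear] bilinear_rneg[OF bilinear] bilinear_lzero[OF bilinear]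
  bilinear_rzero[OF bilinear]

lemmas jp_sum = linear_sum[OF jp_linear] linear_sum[OF jp_linear_left]

lemma unit_right: "x \<circ>\<^sub>J e = x" using unit commute by metis

lemma inner_assoc_left: "inner (x \<circ>\<^sub>J y) z = inner x (y \<circ>\<^sub>J z)"
  using inner_assoc[of y x z] commute[of x y] by simp

lemma inner_jp_unit: "inner (x \<circ>\<^sub>J y) e = inner x y"
  by (simp add: inner_assoc_left unit_right)

lemma unit_nonzero: "e \<noteq> 0"
proof
  assume "e = 0"
  then have "x = 0" for x :: 'a using unit[of x] by (simp add: jp_simps)
  then show False using nonempty_Basis nonzero_Basis by blast
qed

text \<open>
  The Jordan identity is cubic in \<open>x\<close>. Taking the difference of its instances at \<open>x + z\<close> and \<open>x - z\<close>
  leaves twice the part linear in \<open>z\<close> and twice the part cubic in \<open>z\<close>, which is the identity at \<open>z\<close>.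
\<close>

lemma jordan_identity_linearised_once:
  "2 *\<^sub>R (x \<circ>\<^sub>J ((x \<circ>\<^sub>J z) \<circ>\<^sub>J y) - (x \<circ>\<^sub>J z) \<circ>\<^sub>J (x \<circ>\<^sub>J y))
    = (x \<circ>\<^sub>J x) \<circ>\<^sub>J (z \<circ>\<^sub>J y) - z \<circ>\<^sub>J ((x \<circ>\<^sub>J x) \<circ>\<^sub>J y)"
proof -
  define F where "F a = a \<circ>\<^sub>J ((a \<circ>\<^sub>J a) \<circ>\<^sub>J y) - (a \<circ>\<^sub>J a) \<circ>\<^sub>J (a \<circ>\<^sub>J y)" for a
  define D where "D = 2 *\<^sub>R (x \<circ>\<^sub>J ((x \<circ>\<^sub>J z) \<circ>\<^sub>J y) - (x \<circ>\<^sub>J z) \<circ>\<^sub>J (x \<circ>\<^sub>J y))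
    - ((x \<circ>\<^sub>J x) \<circ>\<^sub>J (z \<circ>\<^sub>J y) - z \<circ>\<^sub>J ((x \<circ>\<^sub>J x) \<circ>\<^sub>J y))"
  have "2 *\<^sub>R D = F (x + z) - F (x - z) - 2 *\<^sub>R F z"
    unfolding D_def F_def by (simp add: jp_simps commute[of z x] algebra_simps scaleR_2)
  also have "\<dots> = 0" by (simp add: F_def jordan_identity)
  finally show ?thesis by (simp add: D_def)
qed

text \<open>
  The identity is now quadratic in \<open>x\<close>; polarising once more makes it multilinear.
\<close>

lemma jordan_identity_linearised:
  "x \<circ>\<^sub>J ((y \<circ>\<^sub>J z) \<circ>\<^sub>J w) + y \<circ>\<^sub>J ((x \<circ>\<^sub>J z) \<circ>\<^sub>J w) + z \<circ>\<^sub>J ((x \<circ>\<^sub>J y) \<circ>\<^sub>J w)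
    = (y \<circ>\<^sub>J z) \<circ>\<^sub>J (x \<circ>\<^sub>J w) + (x \<circ>\<^sub>J z) \<circ>\<^sub>J (y \<circ>\<^sub>J w) + (x \<circ>\<^sub>J y) \<circ>\<^sub>J (z \<circ>\<^sub>J w)"
proof -
  define G where "G a = 2 *\<^sub>R (a \<circ>\<^sub>J ((a \<circ>\<^sub>J z) \<circ>\<^sub>J w) - (a \<circ>\<^sub>J z) \<circ>\<^sub>J (a \<circ>\<^sub>J w))
    - ((a \<circ>\<^sub>J a) \<circ>\<^sub>J (z \<circ>\<^sub>J w) - z \<circ>\<^sub>J ((a \<circ>\<^sub>J a) \<circ>\<^sub>J w))" for a
  define D where "D = x \<circ>\<^sub>J ((y \<circ>\<^sub>J z) \<circ>\<^sub>J w) + y \<circ>\<^sub>J ((x \<circ>\<^sub>J z) \<circ>\<^sub>J w) + z \<circ>\<^sub>J ((x \<circ>\<^sub>J y) \<circ>\<^sub>J w)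
    - ((y \<circ>\<^sub>J z) \<circ>\<^sub>J (x \<circ>\<^sub>J w) + (x \<circ>\<^sub>J z) \<circ>\<^sub>J (y \<circ>\<^sub>J w) + (x \<circ>\<^sub>J y) \<circ>\<^sub>J (z \<circ>\<^sub>J w))"
  have "2 *\<^sub>R D = G (x + y) - G x - G y"
    unfolding D_def G_def by (simp add: jp_simps commute[of y x] algebra_simps scaleR_2)
  also have "\<dots> = 0" by (simp add: G_def jordan_identity_linearised_once)
  finally show ?thesis by (simp add: D_def)
qed

text \<open>
  The multilinear identity read as an equation between operators acting on \<open>x\<close>. It expresses the
  multiplication by a triple product through multiplications by products of at most two factors.
\<close>

lemma mult_operator_of_triple_product:
  "((y \<circ>\<^sub>J z) \<circ>\<^sub>J w) \<circ>\<^sub>J x = (y \<circ>\<^sub>J z) \<circ>\<^sub>J (w \<circ>\<^sub>J x) + (y \<circ>\<^sub>J w) \<circ>\<^sub>J (z \<circ>\<^sub>J x)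
    + (z \<circ>\<^sub>J w) \<circ>\<^sub>J (y \<circ>\<^sub>J x) - y \<circ>\<^sub>J (w \<circ>\<^sub>J (z \<circ>\<^sub>J x)) - z \<circ>\<^sub>J (w \<circ>\<^sub>J (y \<circ>\<^sub>J x))"
proof -
  have "x \<circ>\<^sub>J ((y \<circ>\<^sub>J z) \<circ>\<^sub>J w) = ((y \<circ>\<^sub>J z) \<circ>\<^sub>J w) \<circ>\<^sub>J x" by (rule commute)
  moreover have "y \<circ>\<^sub>J ((x \<circ>\<^sub>J z) \<circ>\<^sub>J w) = y \<circ>\<^sub>J (w \<circ>\<^sub>J (z \<circ>\<^sub>J x))" by (metis commute)
  moreover have "z \<circ>\<^sub>J ((x \<circ>\<^sub>J y) \<circ>\<^sub>J w) = z \<circ>\<^sub>J (w \<circ>\<^sub>J (y \<circ>\<^sub>J x))" by (metis commute)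
  moreover have "(y \<circ>\<^sub>J z) \<circ>\<^sub>J (x \<circ>\<^sub>J w) = (y \<circ>\<^sub>J z) \<circ>\<^sub>J (w \<circ>\<^sub>J x)" by (metis commute)
  moreover have "(x \<circ>\<^sub>J z) \<circ>\<^sub>J (y \<circ>\<^sub>J w) = (y \<circ>\<^sub>J w) \<circ>\<^sub>J (z \<circ>\<^sub>J x)" by (metis commute)
  moreover have "(x \<circ>\<^sub>J y) \<circ>\<^sub>J (z \<circ>\<^sub>J w) = (z \<circ>\<^sub>J w) \<circ>\<^sub>J (y \<circ>\<^sub>J x)" by (metis commute)
  ultimately show ?thesis
    using jordan_identity_linearised[of x y z w] by (simp add: algebra_simps)
qed

section \<open>Power associativity\<close>

definition jpow :: "'a \<Rightarrow> nat \<Rightarrow> 'a" where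
  "jpow x n = ((\<circ>\<^sub>J) x ^^ n) e"

lemma jpow_simps [simp]: "jpow x 0 = e" "jpow x (Suc n) = x \<circ>\<^sub>J jpow x n"
  by (simp_all add: jpow_def)

text \<open>
  The previous formula with the factors \<open>x\<^sup>m, x, x\<close> writes \<open>L(x\<^bsup>m+2\<^esup>)\<close> as a polynomial in \<open>L(x\<^bsup>m+1\<^esup>)\<close>,
  \<open>L(x\<^sup>m)\<close>, \<open>L(x\<^sup>2)\<close> and \<open>L(x)\<close>. Inductively all \<open>L(x\<^sup>n)\<close> are polynomials in \<open>L(x)\<close> and \<open>L(x\<^sup>2)\<close>; this
  is recorded as commutation with every \<open>f\<close> that commutes with these two.
\<close>

lemma jpow_mult_in_bicommutant:
  assumes f: "linear f"
    and fx: "\<And>v. f (x \<circ>\<^sub>J v) = x \<circ>\<^sub>J f v"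
    and fxx: "\<And>v. f ((x \<circ>\<^sub>J x) \<circ>\<^sub>J v) = (x \<circ>\<^sub>J x) \<circ>\<^sub>J f v"
  shows "f (jpow x n \<circ>\<^sub>J v) = jpow x n \<circ>\<^sub>J f v"
proof (induction n arbitrary: v rule: less_induct)
  case (less n)
  consider "n = 0" | "n = 1" | m where "n = Suc (Suc m)" by (metis One_nat_def not0_implies_Suc)
  then show ?case
  proof cases
    case 1 then show ?thesis by (simp add: unit)
  next
    case 2 then show ?thesis by (simp add: unit_right fx)
  next
    case 3
    define p where "p = jpow x m"
    have fp: "f (p \<circ>\<^sub>J u) = p \<circ>\<^sub>J f u" for u
      unfolding p_def using less.IH[of m u] 3 by simp
    have fq: "f ((p \<circ>\<^sub>J x) \<circ>\<^sub>J u) = (p \<circ>\<^sub>J x) \<circ>\<^sub>J f u" for u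
      unfolding p_def using less.IH[of "Suc m" u] 3 commute[of x "jpow x m"] by simp
    have "jpow x n = (p \<circ>\<^sub>J x) \<circ>\<^sub>J x" by (simp add: 3 p_def) (metis commute)
    then have "jpow x n \<circ>\<^sub>J u = (p \<circ>\<^sub>J x) \<circ>\<^sub>J (x \<circ>\<^sub>J u) + (p \<circ>\<^sub>J x) \<circ>\<^sub>J (x \<circ>\<^sub>J u)
        + (x \<circ>\<^sub>J x) \<circ>\<^sub>J (p \<circ>\<^sub>J u) - p \<circ>\<^sub>J (x \<circ>\<^sub>J (x \<circ>\<^sub>J u)) - x \<circ>\<^sub>J (x \<circ>\<^sub>J (p \<circ>\<^sub>J u))" for u
      using mult_operator_of_triple_product[of p x x u] by simp
    then show ?thesis
      by (simp add: linear_add[OF f] linear_diff[OF f] fp fq fx fxx)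
  qed
qed

text \<open>
  \<open>L(x)\<close> and \<open>L(x\<^sup>2)\<close> commute by the Jordan identity, hence both commute with \<open>L(x\<^sup>m)\<close>, and then \<open>L(x\<^sup>m)\<close>
  commutes with \<open>L(x\<^sup>n)\<close>: the bicommutant lemma is used three times.
\<close>

lemma jpow_mult_commute: "jpow x m \<circ>\<^sub>J (jpow x n \<circ>\<^sub>J v) = jpow x n \<circ>\<^sub>J (jpow x m \<circ>\<^sub>J v)"
proof (rule jpow_mult_in_bicommutant[OF jp_linear])
  fix v
  have "x \<circ>\<^sub>J (jpow x m \<circ>\<^sub>J v) = jpow x m \<circ>\<^sub>J (x \<circ>\<^sub>J v)" for v
    by (rule jpow_mult_in_bicommutant[OF jp_linear]) (auto simp: jordan_identity)
  then show "jpow x m \<circ>\<^sub>J (x \<circ>\<^sub>J v) = x \<circ>\<^sub>J (jpow x m \<circ>\<^sub>J v)" by simp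
  have "(x \<circ>\<^sub>J x) \<circ>\<^sub>J (jpow x m \<circ>\<^sub>J v) = jpow x m \<circ>\<^sub>J ((x \<circ>\<^sub>J x) \<circ>\<^sub>J v)" for v
    by (rule jpow_mult_in_bicommutant[OF jp_linear]) (auto simp: jordan_identity)
  then show "jpow x m \<circ>\<^sub>J ((x \<circ>\<^sub>J x) \<circ>\<^sub>J v) = (x \<circ>\<^sub>J x) \<circ>\<^sub>J (jpow x m \<circ>\<^sub>J v)" by simp
qed

lemma jpow_add: "jpow x m \<circ>\<^sub>J jpow x n = jpow x (m + n)"
proof (induction n)
  case (Suc n)
  have "jpow x m \<circ>\<^sub>J (jpow x 1 \<circ>\<^sub>J jpow x n) = jpow x 1 \<circ>\<^sub>J (jpow x m \<circ>\<^sub>J jpow x n)"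
    by (rule jpow_mult_commute)
  then show ?case using Suc by (simp add: unit_right)
qed (simp add: unit_right)

definition associative_subalgebra :: "'a set \<Rightarrow> bool" where
  "associative_subalgebra S \<longleftrightarrow> subspace S \<and> (\<forall>a\<in>S. \<forall>b\<in>S. a \<circ>\<^sub>J b \<in> S) \<and>
     (\<forall>a\<in>S. \<forall>b\<in>S. \<forall>c\<in>S. (a \<circ>\<^sub>J b) \<circ>\<^sub>J c = a \<circ>\<^sub>J (b \<circ>\<^sub>J c))"

text \<open>
  On the span of the powers the multiplication operators commute, and for a commutative product
  \<open>L(a) L(c) b = L(c) L(a) b\<close> is the associative law.
\<close>

lemma associative_subalgebra_generated:
  "associative_subalgebra (span (range (jpow x)))"
proof -
  let ?A = "span (range (jpow x))"
  have closed1: "jpow x m \<circ>\<^sub>J b \<in> ?A" if "b \<in> ?A" for m b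
    using that
  proof (induction rule: span_induct)
    case base
    show ?case by (rule linear_subspace_vimage[OF jp_linear subspace_span, unfolded vimage_def])
  next
    case (step y) then show ?case by (auto simp: jpow_add intro: span_base)
  qed
  have closed: "a \<circ>\<^sub>J b \<in> ?A" if "a \<in> ?A" "b \<in> ?A" for a b
    using that(1)
  proof (induction rule: span_induct)
    case base
    show ?case by (rule linear_subspace_vimage[OF jp_linear_left subspace_span, unfolded vimage_def])
  next
    case (step y) then show ?case using closed1 that(2) by auto
  qed
  have comm1: "jpow x m \<circ>\<^sub>J (a \<circ>\<^sub>J v) = a \<circ>\<^sub>J (jpow x m \<circ>\<^sub>J v)" if "a \<in> ?A" for a m v
    using that
  proof (induction rule: span_induct)
    case base
    show ?case by (auto simp: subspace_def jp_simps)
  next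
    case (step y) then show ?case using jpow_mult_commute by auto
  qed
  have comm: "a \<circ>\<^sub>J (b \<circ>\<^sub>J v) = b \<circ>\<^sub>J (a \<circ>\<^sub>J v)" if "a \<in> ?A" "b \<in> ?A" for a b v
    using that(1)
  proof (induction rule: span_induct)
    case base
    show ?case by (auto simp: subspace_def jp_simps)
  next
    case (step y) then show ?case using comm1 that(2) by auto
  qed
  have "(a \<circ>\<^sub>J b) \<circ>\<^sub>J c = a \<circ>\<^sub>J (b \<circ>\<^sub>J c)" if "a \<in> ?A" "b \<in> ?A" "c \<in> ?A" for a b c
    using comm[of c a b] that by (metis commute)
  then show ?thesis using closed unfolding associative_subalgebra_def by blast
qed

section \<open>The spectral theorem\<close>

definition orthogonal_idempotents :: "'a set \<Rightarrow> bool" where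
  "orthogonal_idempotents C \<longleftrightarrow> finite C \<and> (\<forall>c\<in>C. idempotent (\<circ>\<^sub>J) c \<and> c \<noteq> 0) \<and>
     (\<forall>c\<in>C. \<forall>d\<in>C. c \<noteq> d \<longrightarrow> c \<circ>\<^sub>J d = 0)"

lemma inner_idempotent_left: "idempotent (\<circ>\<^sub>J) c \<Longrightarrow> inner c x = inner c (c \<circ>\<^sub>J x)"
  by (metis idempotent_def inner_assoc)

text \<open>
  Take a nonzero ideal \<open>I\<close> of least dimension. Each \<open>a \<in> S\<close> has an eigenvector in \<open>I\<close>, and by
  associativity its eigenspace in \<open>I\<close> is again an ideal, hence all of \<open>I\<close>. So \<open>S\<close> acts on \<open>I\<close> by
  scalars. In particular \<open>w \<circ> w = m w\<close> for \<open>w \<in> I\<close>, where \<open>m \<noteq> 0\<close> because \<open>\<langle>w \<circ> w, e\<rangle> = \<langle>w, w\<rangle>\<close>,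
  and \<open>w / m\<close> is idempotent.
\<close>

lemma associative_subalgebra_has_minimal_idempotent:
  assumes S: "associative_subalgebra S" and nz: "S \<noteq> {0}"
  shows "\<exists>c\<in>S. idempotent (\<circ>\<^sub>J) c \<and> c \<noteq> 0 \<and> (\<forall>a\<in>S. \<exists>l. a \<circ>\<^sub>J c = l *\<^sub>R c)"
proof -
  define ideal where "ideal I \<longleftrightarrow> subspace I \<and> I \<noteq> {0} \<and> I \<subseteq> S \<and> (\<forall>a\<in>S. \<forall>w\<in>I. a \<circ>\<^sub>J w \<in> I)" for I
  have "ideal S" using S nz unfolding ideal_def associative_subalgebra_def by auto
  then obtain I where I: "ideal I" and least: "\<And>J. ideal J \<Longrightarrow> dim I \<le> dim J"
    using ex_has_least_nat[of ideal S dim] by blast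
  have scalar: "\<exists>l. \<forall>w\<in>I. a \<circ>\<^sub>J w = l *\<^sub>R w" if a: "a \<in> S" for a
  proof -
    obtain w l where w: "w \<in> I" "w \<noteq> 0" "a \<circ>\<^sub>J w = l *\<^sub>R w"
      using self_adjoint_has_eigenvector[OF jp_linear[of a], of I] I a inner_assoc
      unfolding ideal_def by blast
    define J where "J = {w \<in> I. a \<circ>\<^sub>J w = l *\<^sub>R w}"
    have "b \<circ>\<^sub>J v \<in> J" if "b \<in> S" "v \<in> J" for b v
    proof -
      have v: "v \<in> I" "v \<in> S" "a \<circ>\<^sub>J v = l *\<^sub>R v" using that I unfolding J_def ideal_def by auto
      have "a \<circ>\<^sub>J (b \<circ>\<^sub>J v) = b \<circ>\<^sub>J (a \<circ>\<^sub>J v)"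
        using S a that(1) v(2) unfolding associative_subalgebra_def by (metis commute)
      then show ?thesis using v that(1) I unfolding J_def ideal_def by (simp add: jp_simps)
    qed
    moreover have "subspace J" using I unfolding J_def ideal_def subspace_def
      by (simp add: jp_simps algebra_simps)
    ultimately have "ideal J" using w I unfolding ideal_def J_def by blast
    then have "J = I"
      using least I \<open>subspace J\<close> by (intro subspace_dim_equal) (auto simp: ideal_def J_def)
    then show ?thesis unfolding J_def by blast
  qed
  obtain w where w: "w \<in> I" "w \<noteq> 0"
    using I subspace_0 unfolding ideal_def by blast
  then have wS: "w \<in> S" using I unfolding ideal_def by blast
  then obtain m where m: "w \<circ>\<^sub>J w = m *\<^sub>R w" using scalar w(1) by blast
  have "m \<noteq> 0" using m inner_jp_unit[of w w] w(2) by auto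
  define c where "c = (1 / m) *\<^sub>R w"
  have "c \<in> I" "c \<in> S"
    using w(1) wS I S unfolding c_def ideal_def associative_subalgebra_def
    by (auto simp: subspace_scale)
  moreover have "c \<noteq> 0" "idempotent (\<circ>\<^sub>J) c"
    using \<open>m \<noteq> 0\<close> w(2) m by (auto simp: c_def idempotent_def jp_simps)
  ultimately show ?thesis using scalar by blast
qed

text \<open>
  A minimal idempotent \<open>c\<close> splits \<open>S\<close> into the line of \<open>c\<close> and the annihilator of \<open>c\<close>, which is a
  smaller subalgebra of the same kind.
\<close>

lemma associative_subalgebra_spanned_by_idempotents:
  assumes "associative_subalgebra S"
  shows "\<exists>C. orthogonal_idempotents C \<and> C \<subseteq> S \<and> S \<subseteq> span C"
  using assms
proof (induction "dim S" arbitrary: S rule: less_induct)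
  case less
  show ?case
  proof (cases "S = {0}")
    case True
    then show ?thesis by (intro exI[of _ "{}"]) (simp add: orthogonal_idempotents_def)
  next
    case False
    then obtain c where c: "c \<in> S" "idempotent (\<circ>\<^sub>J) c" "c \<noteq> 0"
      and scalar: "\<And>a. a \<in> S \<Longrightarrow> \<exists>l. a \<circ>\<^sub>J c = l *\<^sub>R c"
      using associative_subalgebra_has_minimal_idempotent[OF less.prems] by blast
    define S' where "S' = {a \<in> S. a \<circ>\<^sub>J c = 0}"
    have S': "associative_subalgebra S'"
      using less.prems c(1) unfolding S'_def associative_subalgebra_def subspace_def
      by (simp add: jp_simps)
    have "c \<notin> S'" using c unfolding S'_def idempotent_def by auto
    have "dim S' < dim S"
    proof (rule ccontr)
      assume "\<not> dim S' < dim S"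
      then have "S' = S" using S' less.prems
        by (intro subspace_dim_equal) (auto simp: associative_subalgebra_def S'_def)
      then show False using c(1) \<open>c \<notin> S'\<close> by blast
    qed
    then obtain C where C: "orthogonal_idempotents C" "C \<subseteq> S'" "S' \<subseteq> span C"
      using less.hyps S' by blast
    have "d \<circ>\<^sub>J c = 0 \<and> c \<circ>\<^sub>J d = 0" if "d \<in> C" for d
      using that C(2) commute[of c d] unfolding S'_def by auto
    then have "orthogonal_idempotents (insert c C)"
      using C(1) c unfolding orthogonal_idempotents_def by simp
    moreover have "a \<in> span (insert c C)" if a: "a \<in> S" for a
    proof -
      obtain l where l: "a \<circ>\<^sub>J c = l *\<^sub>R c" using scalar[OF a] by blast
      have "a - l *\<^sub>R c \<in> S'"
        using a c l less.prems unfolding S'_def associative_subalgebra_def idempotent_def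
        by (auto simp: jp_simps subspace_diff subspace_scale)
      then show ?thesis using C(3) span_breakdown_eq by blast
    qed
    ultimately show ?thesis using C(2) c(1) unfolding S'_def
      by (intro exI[of _ "insert c C"]) auto
  qed
qed

theorem spectral_theorem:
  "\<exists>C l. orthogonal_idempotents C \<and> x = (\<Sum>c\<in>C. l c *\<^sub>R c)"
proof -
  let ?A = "span (range (jpow x))"
  obtain C where C: "orthogonal_idempotents C" "?A \<subseteq> span C"
    using associative_subalgebra_spanned_by_idempotents[OF associative_subalgebra_generated]
    by blast
  have "jpow x 1 \<in> ?A" by (intro span_base rangeI)
  then have "x \<in> span C" using C(2) by (auto simp: unit_right)
  then show ?thesis
    using C(1) span_finite[of C] unfolding orthogonal_idempotents_def by auto
qed

lemma orthogonal_idempotents_mult: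
  assumes C: "orthogonal_idempotents C" and d: "d \<in> C"
  shows "(\<Sum>c\<in>C. l c *\<^sub>R c) \<circ>\<^sub>J d = l d *\<^sub>R d"
proof -
  have "(\<Sum>c\<in>C. l c *\<^sub>R c) \<circ>\<^sub>J d = (\<Sum>c\<in>C. l c *\<^sub>R (c \<circ>\<^sub>J d))" by (simp add: jp_sum jp_simps)
  also have "\<dots> = (\<Sum>c\<in>C. if c = d then l d *\<^sub>R d else 0)"
    using C d by (intro sum.cong) (auto simp: orthogonal_idempotents_def idempotent_def)
  finally show ?thesis using C d by (simp add: orthogonal_idempotents_def)
qed

lemma orthogonal_idempotents_square:
  assumes C: "orthogonal_idempotents C"
  shows "(\<Sum>c\<in>C. l c *\<^sub>R c) \<circ>\<^sub>J (\<Sum>c\<in>C. l c *\<^sub>R c) = (\<Sum>c\<in>C. (l c)\<^sup>2 *\<^sub>R c)"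
proof -
  let ?x = "\<Sum>c\<in>C. l c *\<^sub>R c"
  have "?x \<circ>\<^sub>J ?x = (\<Sum>d\<in>C. l d *\<^sub>R (?x \<circ>\<^sub>J d))"
    using linear_sum[OF jp_linear[of ?x], of "\<lambda>c. l c *\<^sub>R c" C] by (simp add: jp_simps)
  also have "\<dots> = (\<Sum>d\<in>C. (l d)\<^sup>2 *\<^sub>R d)"
    by (intro sum.cong refl) (simp add: orthogonal_idempotents_mult[OF C] power2_eq_square)
  finally show ?thesis .
qed

section \<open>The symmetric cone\<close>

abbreviation K :: "'a set" where "K \<equiv> symmetric_cone (\<circ>\<^sub>J)"

text \<open>
  The triple product formula at \<open>c, c, c\<close> reads \<open>2 L\<^sup>3 - 3 L\<^sup>2 + L = 0\<close> for \<open>L = L(c)\<close>, so that the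
  eigenvalues of \<open>L\<close> are among \<open>0\<close>, \<open>1/2\<close> and \<open>1\<close>. On these three numbers the polynomial \<open>t\<close> agrees
  with the sum of squares \<open>t\<^sup>2 + 4 (t - t\<^sup>2)\<^sup>2\<close>.
\<close>

lemma idempotent_mult_psd:
  assumes "idempotent (\<circ>\<^sub>J) c"
  shows "0 \<le> inner (c \<circ>\<^sub>J v) v"
proof -
  define u1 where "u1 = c \<circ>\<^sub>J v"
  define u2 where "u2 = c \<circ>\<^sub>J u1"
  define u3 where "u3 = c \<circ>\<^sub>J u2"
  have u: "u1 = u2 + u2 + u2 - u3 - u3"
    using mult_operator_of_triple_product[of c c c v] assms
    by (simp add: idempotent_def u1_def u2_def u3_def)
  have "inner u1 v = 3 * inner u2 v - 2 * inner u3 v"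
    by (subst u) (simp add: inner_diff_left inner_add_left)
  moreover have "inner u1 u1 = 3 * inner u2 u1 - 2 * inner u3 u1"
    by (subst u) (simp add: inner_diff_left inner_add_left)
  moreover have "inner u2 v = inner u1 u1" "inner u3 v = inner u2 u1" "inner u3 u1 = inner u2 u2"
    unfolding u2_def u3_def u1_def by (simp_all add: inner_assoc)
  moreover have "inner (u1 - u2) (u1 - u2) = inner u1 u1 - 2 * inner u2 u1 + inner u2 u2"
    by (simp add: inner_diff_left inner_diff_right inner_commute)
  ultimately have "inner u1 v = inner u1 u1 + 4 * inner (u1 - u2) (u1 - u2)" by linarith
  also have "\<dots> \<ge> 0" by simp
  finally show ?thesis unfolding u1_def .
qed

text \<open>
  A square has nonnegative spectral coefficients and is thus a nonnegative combination of operators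
  \<open>L(c)\<close>. Conversely, testing \<open>L(x)\<close> on the spectral idempotents of \<open>x\<close> shows that the coefficients
  are nonnegative, and then a square root can be taken coefficientwise.
\<close>

lemma symmetric_cone_iff_psd: "x \<in> K \<longleftrightarrow> (\<forall>z. 0 \<le> inner (x \<circ>\<^sub>J z) z)"
proof
  assume "x \<in> K"
  then obtain y where y: "x = y \<circ>\<^sub>J y" unfolding symmetric_cone_def by blast
  obtain C l where C: "orthogonal_idempotents C" and yC: "y = (\<Sum>c\<in>C. l c *\<^sub>R c)"
    using spectral_theorem by blast
  have "0 \<le> inner (x \<circ>\<^sub>J z) z" for z
  proof -
    have "x = (\<Sum>c\<in>C. (l c)\<^sup>2 *\<^sub>R c)" using orthogonal_idempotents_square[OF C] y yC by simp
    then have "inner (x \<circ>\<^sub>J z) z = (\<Sum>c\<in>C. (l c)\<^sup>2 * inner (c \<circ>\<^sub>J z) z)"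
      by (simp add: jp_sum jp_simps inner_sum_left)
    also have "\<dots> \<ge> 0"
      using C idempotent_mult_psd by (intro sum_nonneg) (auto simp: orthogonal_idempotents_def)
    finally show ?thesis .
  qed
  then show "\<forall>z. 0 \<le> inner (x \<circ>\<^sub>J z) z" by blast
next
  assume psd: "\<forall>z. 0 \<le> inner (x \<circ>\<^sub>J z) z"
  obtain C l where C: "orthogonal_idempotents C" and x: "x = (\<Sum>c\<in>C. l c *\<^sub>R c)"
    using spectral_theorem by blast
  have "0 \<le> l c" if c: "c \<in> C" for c
  proof -
    have "0 \<le> inner (l c *\<^sub>R c) c"
      using psd orthogonal_idempotents_mult[OF C c, of l] x by metis
    moreover have "0 < inner c c" using C c by (simp add: orthogonal_idempotents_def)
    ultimately show ?thesis by (simp add: zero_le_mult_iff)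
  qed
  then have "x = (\<Sum>c\<in>C. (sqrt (l c))\<^sup>2 *\<^sub>R c)" unfolding x by (intro sum.cong) auto
  then have "x = (\<Sum>c\<in>C. sqrt (l c) *\<^sub>R c) \<circ>\<^sub>J (\<Sum>c\<in>C. sqrt (l c) *\<^sub>R c)"
    by (simp only: orthogonal_idempotents_square[OF C])
  then show "x \<in> K" unfolding symmetric_cone_def by (rule range_eqI)
qed

lemma symmetric_cone_iff_dual: "x \<in> K \<longleftrightarrow> (\<forall>z. 0 \<le> inner x (z \<circ>\<^sub>J z))"
  by (simp add: symmetric_cone_iff_psd inner_assoc_left)

lemma symmetric_cone_inner_nonneg: "x \<in> K \<Longrightarrow> y \<in> K \<Longrightarrow> 0 \<le> inner x y"
  unfolding symmetric_cone_iff_dual[of x] by (auto simp: symmetric_cone_def)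

lemma symmetric_cone_zero: "0 \<in> K"
  and symmetric_cone_add: "x \<in> K \<Longrightarrow> y \<in> K \<Longrightarrow> x + y \<in> K"
  and symmetric_cone_scale: "x \<in> K \<Longrightarrow> 0 \<le> a \<Longrightarrow> a *\<^sub>R x \<in> K"
  by (simp_all add: symmetric_cone_iff_dual inner_add_left)

lemma symmetric_cone_sum: "(\<And>i. i \<in> I \<Longrightarrow> f i \<in> K) \<Longrightarrow> sum f I \<in> K"
  by (induction I rule: infinite_finite_induct)
    (auto intro: symmetric_cone_zero symmetric_cone_add)

lemma closed_symmetric_cone: "closed K"
proof -
  have "K = (\<Inter>z. {x. 0 \<le> inner (z \<circ>\<^sub>J z) x})"
    by (auto simp: symmetric_cone_iff_dual inner_commute)
  then show ?thesis by (simp add: closed_INT closed_halfspace_ge)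
qed

lemma idempotent_in_symmetric_cone: "idempotent (\<circ>\<^sub>J) c \<Longrightarrow> c \<in> K"
  unfolding symmetric_cone_def idempotent_def by (rule range_eqI[of _ _ c]) simp

lemma unit_idempotent: "idempotent (\<circ>\<^sub>J) e"
  by (simp add: idempotent_def unit)

lemma idempotent_complement: "idempotent (\<circ>\<^sub>J) c \<Longrightarrow> idempotent (\<circ>\<^sub>J) (e - c)"
  by (simp add: idempotent_def jp_simps unit unit_right)

lemma idempotent_diff:
  "idempotent (\<circ>\<^sub>J) c \<Longrightarrow> idempotent (\<circ>\<^sub>J) d \<Longrightarrow> c \<circ>\<^sub>J d = c \<Longrightarrow> idempotent (\<circ>\<^sub>J) (d - c)"
  by (simp add: idempotent_def jp_simps commute[of d c])

lemma symmetric_cone_orthogonal_idempotent: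
  assumes x: "x \<in> K" and c: "idempotent (\<circ>\<^sub>J) c" and xc: "inner x c = 0"
  shows "x \<circ>\<^sub>J c = 0"
proof (rule psd_form_zero_imp_kernel[OF jp_linear[of x], of UNIV])
  show "inner (x \<circ>\<^sub>J c) c = 0" using c xc by (simp add: inner_assoc_left idempotent_def)
qed (use x in \<open>auto simp: symmetric_cone_iff_psd inner_assoc\<close>)

lemma symmetric_cone_peirce_one_iff:
  assumes x: "x \<in> K" and c: "idempotent (\<circ>\<^sub>J) c"
  shows "x \<in> peirce_one (\<circ>\<^sub>J) c \<longleftrightarrow> inner x (e - c) = 0"
proof
  assume "x \<in> peirce_one (\<circ>\<^sub>J) c"
  then have "x \<circ>\<^sub>J c = x" by (simp add: peirce_one_def)
  then show "inner x (e - c) = 0"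
    using inner_jp_unit[of x c] inner_jp_unit[of x e] by (simp add: inner_diff_right unit_right)
next
  assume "inner x (e - c) = 0"
  then have "x \<circ>\<^sub>J (e - c) = 0"
    by (rule symmetric_cone_orthogonal_idempotent[OF x idempotent_complement[OF c]])
  then show "x \<in> peirce_one (\<circ>\<^sub>J) c" by (simp add: peirce_one_def jp_simps unit_right)
qed

text \<open>
  The support \<open>c\<close> is the sum of the spectral idempotents of \<open>x\<close> with positive coefficient.
\<close>

lemma symmetric_cone_support:
  assumes x: "x \<in> K"
  obtains c a b where "idempotent (\<circ>\<^sub>J) c" "0 < a" "0 < b" "x - a *\<^sub>R c \<in> K" "b *\<^sub>R c - x \<in> K"
proof -
  obtain C l where C: "orthogonal_idempotents C" and xC: "x = (\<Sum>c\<in>C. l c *\<^sub>R c)"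
    using spectral_theorem by blast
  have l: "0 \<le> l c" if c: "c \<in> C" for c
  proof -
    have "0 \<le> inner (l c *\<^sub>R c) c"
      using x orthogonal_idempotents_mult[OF C c, of l] xC
      unfolding symmetric_cone_iff_psd by metis
    moreover have "0 < inner c c" using C c by (simp add: orthogonal_idempotents_def)
    ultimately show ?thesis by (simp add: zero_le_mult_iff)
  qed
  define D where "D = {c \<in> C. l c \<noteq> 0}"
  have D: "orthogonal_idempotents D" using C by (auto simp: D_def orthogonal_idempotents_def)
  then have fin: "finite D" by (simp add: orthogonal_idempotents_def)
  have xD: "x = (\<Sum>c\<in>D. l c *\<^sub>R c)"
    unfolding xC D_def using C
    by (intro sum.mono_neutral_right) (auto simp: orthogonal_idempotents_def)
  have DK: "c \<in> K" if "c \<in> D" for c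
    using that D by (auto simp: orthogonal_idempotents_def intro: idempotent_in_symmetric_cone)
  \<comment> \<open>The extra \<open>1\<close> in both bounds keeps them positive when \<open>x = 0\<close>.\<close>
  define a where "a = Min (insert 1 (l ` D))"
  define b where "b = 1 + sum l D"
  have pos: "0 < l c" if "c \<in> D" for c using that l[of c] by (simp add: D_def)
  then have a: "0 < a" "\<And>c. c \<in> D \<Longrightarrow> a \<le> l c"
    using fin by (auto simp: a_def)
  have "0 \<le> sum l D" using pos by (intro sum_nonneg less_imp_le)
  moreover have "l c \<le> sum l D" if "c \<in> D" for c
    using that pos fin by (intro member_le_sum less_imp_le) auto
  ultimately have b: "0 < b" "\<And>c. c \<in> D \<Longrightarrow> l c \<le> b"
    unfolding b_def by (auto intro: add_increasing)
  have "idempotent (\<circ>\<^sub>J) (\<Sum>D)"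
    using orthogonal_idempotents_square[OF D, of "\<lambda>_. 1"] by (simp add: idempotent_def)
  moreover have "x - a *\<^sub>R \<Sum>D = (\<Sum>c\<in>D. (l c - a) *\<^sub>R c)"
    "b *\<^sub>R \<Sum>D - x = (\<Sum>c\<in>D. (b - l c) *\<^sub>R c)"
    by (simp_all add: xD scaleR_sum_right scaleR_diff_left sum_subtractf)
  then have "x - a *\<^sub>R \<Sum>D \<in> K" "b *\<^sub>R \<Sum>D - x \<in> K"
    using a b DK by (auto intro!: symmetric_cone_sum symmetric_cone_scale)
  ultimately show ?thesis using that a(1) b(1) by blast
qed

lemma symmetric_cone_pointed: "x \<in> K \<Longrightarrow> - x \<in> K \<Longrightarrow> x = 0"
  using symmetric_cone_inner_nonneg[of "- x" x] 
  by (simp add: dot_square_norm)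

text \<open>
  If \<open>x \<ge> a e\<close> then \<open>L(x) \<ge> a\<close> as an operator, and \<open>L\<close> is bounded, so a small perturbation of \<open>x\<close>
  keeps \<open>L(x)\<close> positive semidefinite.
\<close>

lemma interior_symmetric_cone_iff: "x \<in> interior K \<longleftrightarrow> (\<exists>a>0. x - a *\<^sub>R e \<in> K)"
proof
  assume "x \<in> interior K"
  then obtain r where r: "0 < r" "ball x r \<subseteq> K" by (auto simp: mem_interior)
  define a where "a = r / (2 * norm e)"
  have "x - a *\<^sub>R e \<in> ball x r"
    using r unit_nonzero by (simp add: dist_norm a_def)
  moreover have "0 < a" using r unit_nonzero by (simp add: a_def)
  ultimately show "\<exists>a>0. x - a *\<^sub>R e \<in> K" using r(2) by blast
next
  assume "\<exists>a>0. x - a *\<^sub>R e \<in> K"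
  then obtain a where a: "0 < a" "x - a *\<^sub>R e \<in> K" by blast
  obtain B where B: "0 < B" "\<And>y z. norm (y \<circ>\<^sub>J z) \<le> B * norm y * norm z"
    using bilinear_bounded_pos[OF bilinear] by blast
  have "y \<in> K" if y: "norm (y - x) < a / B" for y
    unfolding symmetric_cone_iff_psd
  proof
    fix z
    have "\<bar>inner ((y - x) \<circ>\<^sub>J z) z\<bar> \<le> norm ((y - x) \<circ>\<^sub>J z) * norm z"
      by (rule Cauchy_Schwarz_ineq2)
    also have "\<dots> \<le> (B * norm (y - x) * norm z) * norm z"
      by (intro mult_right_mono B) simp
    also have "\<dots> = (B * norm (y - x)) * inner z z"
      by (simp add: power2_eq_square dot_square_norm)
    also have "\<dots> \<le> a * inner z z"
      using y B(1) by (intro mult_right_mono) (auto simp: field_simps)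
    finally have "\<bar>inner ((y - x) \<circ>\<^sub>J z) z\<bar> \<le> a * inner z z" .
    moreover have "0 \<le> inner ((x - a *\<^sub>R e) \<circ>\<^sub>J z) z"
      using a(2) unfolding symmetric_cone_iff_psd by blast
    moreover have "inner (y \<circ>\<^sub>J z) z
        = inner ((y - x) \<circ>\<^sub>J z) z + inner ((x - a *\<^sub>R e) \<circ>\<^sub>J z) z + a * inner z z"
      by (simp add: jp_simps unit inner_diff_left)
    ultimately show "0 \<le> inner (y \<circ>\<^sub>J z) z" by linarith
  qed
  then have "ball x (a / B) \<subseteq> K" by (auto simp: dist_norm norm_minus_commute)
  then show "x \<in> interior K" using a(1) B(1) unfolding mem_interior
    by (intro exI[of _ "a / B"]) simp
qed

section \<open>Idempotents and the faces of the cone\<close>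

lemma subspace_peirce_one: "subspace (peirce_one (\<circ>\<^sub>J) c)"
  by (auto simp: peirce_one_def subspace_def jp_simps)

lemma idempotent_mem_peirce_one: "idempotent (\<circ>\<^sub>J) c \<Longrightarrow> c \<in> peirce_one (\<circ>\<^sub>J) c"
  by (simp add: peirce_one_def idempotent_def)

text \<open>
  The square lies in \<open>K\<close>, where membership in \<open>V(c,1)\<close> means orthogonality to \<open>e - c\<close>; and
  \<open>\<langle>x \<circ> x, e - c\<rangle> = \<langle>x, x \<circ> (e - c)\<rangle>\<close>, whose second factor vanishes.
\<close>

lemma peirce_one_square:
  assumes c: "idempotent (\<circ>\<^sub>J) c" and x: "x \<in> peirce_one (\<circ>\<^sub>J) c"
  shows "x \<circ>\<^sub>J x \<in> K \<inter> peirce_one (\<circ>\<^sub>J) c"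
proof -
  have K: "x \<circ>\<^sub>J x \<in> K" unfolding symmetric_cone_def by blast
  have "inner (x \<circ>\<^sub>J x) (e - c) = inner x (x \<circ>\<^sub>J (e - c))" by (rule inner_assoc_left)
  also have "\<dots> = 0" using x by (simp add: peirce_one_def jp_simps unit_right)
  finally show ?thesis using symmetric_cone_peirce_one_iff[OF K c] K by blast
qed

text \<open>
  Together with the converse below: within \<open>K\<close>, the space \<open>V(c,1)\<close> consists of the elements bounded by
  multiples of \<open>c\<close>.
\<close>

lemma dominated_imp_peirce_one:
  assumes c: "idempotent (\<circ>\<^sub>J) c" and x: "x \<in> K" and a: "0 < a"
    and le: "b *\<^sub>R c - a *\<^sub>R x \<in> K"
  shows "x \<in> peirce_one (\<circ>\<^sub>J) c"
proof -
  have compl: "e - c \<in> K" by (rule idempotent_in_symmetric_cone[OF idempotent_complement[OF c]])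
  have "inner c (e - c) = 0"
    using symmetric_cone_peirce_one_iff[OF idempotent_in_symmetric_cone c]
      idempotent_mem_peirce_one c by blast
  then have "a * inner x (e - c) \<le> 0"
    using symmetric_cone_inner_nonneg[OF le compl] by (simp add: inner_diff_left)
  then have "inner x (e - c) = 0"
    using symmetric_cone_inner_nonneg[OF x compl] a by (simp add: mult_le_0_iff)
  then show ?thesis using symmetric_cone_peirce_one_iff[OF x c] by blast
qed

text \<open>
  The support \<open>d\<close> of \<open>x\<close> is orthogonal to \<open>e - c\<close> with \<open>x\<close>, so \<open>c - d\<close> is an idempotent and \<open>d \<le> c\<close>.
\<close>

lemma peirce_one_imp_dominated:
  assumes c: "idempotent (\<circ>\<^sub>J) c" and x: "x \<in> K" "x \<in> peirce_one (\<circ>\<^sub>J) c"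
  shows "\<exists>t>0. t *\<^sub>R c - x \<in> K"
proof -
  obtain d a b where d: "idempotent (\<circ>\<^sub>J) d" "0 < a" "0 < b" "x - a *\<^sub>R d \<in> K" "b *\<^sub>R d - x \<in> K"
    using symmetric_cone_support[OF x(1)] by blast
  have compl: "e - c \<in> K" by (rule idempotent_in_symmetric_cone[OF idempotent_complement[OF c]])
  have dK: "d \<in> K" using d(1) by (rule idempotent_in_symmetric_cone)
  have "inner x (e - c) = 0" using symmetric_cone_peirce_one_iff x c by blast
  then have "a * inner d (e - c) \<le> 0"
    using symmetric_cone_inner_nonneg[OF d(4) compl] by (simp add: inner_diff_left)
  then have "inner d (e - c) = 0"
    using symmetric_cone_inner_nonneg[OF dK compl] d(2) by (simp add: mult_le_0_iff)
  then have "d \<circ>\<^sub>J c = d"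
    using symmetric_cone_peirce_one_iff[OF dK c] by (simp add: peirce_one_def)
  then have "b *\<^sub>R (c - d) \<in> K"
    using d c by (intro symmetric_cone_scale idempotent_in_symmetric_cone idempotent_diff) auto
  then have "b *\<^sub>R c - x \<in> K"
    using symmetric_cone_add[OF _ d(5)] by (fastforce simp: scaleR_diff_right)
  then show ?thesis using d(3) by blast
qed

lemma cone_face_peirce_one:
  assumes c: "idempotent (\<circ>\<^sub>J) c"
  shows "cone_face K (K \<inter> peirce_one (\<circ>\<^sub>J) c)"
proof -
  have compl: "e - c \<in> K" by (rule idempotent_in_symmetric_cone[OF idempotent_complement[OF c]])
  have "convex_cone (K \<inter> peirce_one (\<circ>\<^sub>J) c)"
    using subspace_peirce_one[of c] symmetric_cone_zero
    by (auto simp: convex_cone_iff subspace_def intro: symmetric_cone_add symmetric_cone_scale)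
  moreover have "b \<in> peirce_one (\<circ>\<^sub>J) c \<and> d \<in> peirce_one (\<circ>\<^sub>J) c"
    if b: "b \<in> K" and d: "d \<in> K" and s: "b + d \<in> peirce_one (\<circ>\<^sub>J) c" for b d
  proof -
    have "inner b (e - c) + inner d (e - c) = 0"
      using symmetric_cone_peirce_one_iff[OF symmetric_cone_add[OF b d] c] s
      by (simp add: inner_add_left)
    then have "inner b (e - c) = 0" "inner d (e - c) = 0"
      using symmetric_cone_inner_nonneg[OF b compl] symmetric_cone_inner_nonneg[OF d compl]
      by linarith+
    then show ?thesis using symmetric_cone_peirce_one_iff b d c by blast
  qed
  ultimately show ?thesis unfolding cone_face_def by blast
qed

lemma idempotent_norm_mono:
  assumes c: "idempotent (\<circ>\<^sub>J) c" and cd: "c \<in> peirce_one (\<circ>\<^sub>J) d"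
  shows "inner d d = inner c c + inner (d - c) (d - c)"
proof -
  have "inner c d = inner c c"
    using inner_idempotent_left[OF c, of d] cd by (simp add: peirce_one_def)
  then show ?thesis by (simp add: inner_diff_left inner_diff_right inner_commute)
qed

lemma idempotent_mem_peirce_one_unit: "e \<in> peirce_one (\<circ>\<^sub>J) c \<Longrightarrow> c = e"
  by (simp add: peirce_one_def unit)

text \<open>
  If \<open>y\<close> dominates a multiple of \<open>e\<close> and is dominated by a multiple of \<open>c\<close>, then so is \<open>e\<close>.
\<close>

lemma interior_peirce_one_imp_unit:
  assumes c: "idempotent (\<circ>\<^sub>J) c" and y: "y \<in> interior K" "y \<in> peirce_one (\<circ>\<^sub>J) c"
  shows "c = e"
proof -
  obtain a where a: "0 < a" "y - a *\<^sub>R e \<in> K" using y(1) interior_symmetric_cone_iff by blast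
  have "y \<in> K" using y(1) interior_subset by blast
  then obtain t where "0 < t" "t *\<^sub>R c - y \<in> K" using peirce_one_imp_dominated[OF c] y(2) by blast
  then have "t *\<^sub>R c - a *\<^sub>R e \<in> K" using symmetric_cone_add[OF _ a(2)] by fastforce
  then have "e \<in> peirce_one (\<circ>\<^sub>J) c"
    using a(1) idempotent_in_symmetric_cone[OF unit_idempotent]
    by (intro dominated_imp_peirce_one[OF c])
  then show ?thesis by (rule idempotent_mem_peirce_one_unit)
qed

section \<open>Rank and trace\<close>

lemma sum_of_idempotents_orthogonal:
  assumes "idempotent (\<circ>\<^sub>J) a" "idempotent (\<circ>\<^sub>J) b" "idempotent (\<circ>\<^sub>J) (a + b)"
  shows "a \<circ>\<^sub>J b = 0"
proof -
  have "2 *\<^sub>R (a \<circ>\<^sub>J b) = (a + b) \<circ>\<^sub>J (a + b) - a \<circ>\<^sub>J a - b \<circ>\<^sub>J b"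
    by (simp add: jp_simps scaleR_2 commute[of b a])
  then show ?thesis using assms by (simp add: idempotent_def)
qed

lemma idempotent_summand_orthogonal:
  assumes a: "idempotent (\<circ>\<^sub>J) a" and b: "idempotent (\<circ>\<^sub>J) b" and f: "idempotent (\<circ>\<^sub>J) f"
    and "(a + b) \<circ>\<^sub>J f = 0"
  shows "a \<circ>\<^sub>J f = 0"
proof -
  have aK: "a \<in> K" and bK: "b \<in> K" and fK: "f \<in> K"
    using a b f by (auto intro: idempotent_in_symmetric_cone)
  have "inner a f + inner b f = 0"
    using inner_jp_unit[of "a + b" f] assms(4) by (simp add: inner_add_left)
  then have "inner a f = 0"
    using symmetric_cone_inner_nonneg[OF aK fK] symmetric_cone_inner_nonneg[OF bK fK] by linarith
  then show ?thesis by (rule symmetric_cone_orthogonal_idempotent[OF aK f])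
qed

lemma orthogonal_idempotents_inner:
  assumes C: "orthogonal_idempotents C" and "c \<in> C" "d \<in> C" "c \<noteq> d"
  shows "inner c d = 0"
  using assms inner_jp_unit[of c d] by (simp add: orthogonal_idempotents_def)

lemma orthogonal_idempotents_card:
  assumes C: "orthogonal_idempotents C"
  shows "card C \<le> DIM('a)"
proof -
  have "pairwise orthogonal C"
    using orthogonal_idempotents_inner[OF C] by (auto simp: pairwise_def orthogonal_def)
  then have "independent C"
    using C by (intro pairwise_orthogonal_independent) (auto simp: orthogonal_idempotents_def)
  then show ?thesis using independent_bound by blast
qed

text \<open>
  Among the decompositions of \<open>c\<close> into nonzero orthogonal idempotents, whose cardinality is bounded by
  the dimension, take one of maximal cardinality. A member that is not primitive could be split into
  \<open>a + b\<close>, and \<open>a\<close>, \<open>b\<close> remain orthogonal to the other members.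
\<close>

lemma idempotent_primitive_decomposition:
  assumes c: "idempotent (\<circ>\<^sub>J) c"
  shows "\<exists>E. orthogonal_idempotents E \<and> (\<forall>d\<in>E. primitive_idempotent (\<circ>\<^sub>J) d) \<and> \<Sum>E = c"
proof -
  define P where "P F \<longleftrightarrow> orthogonal_idempotents F \<and> \<Sum>F = c" for F
  have "P ({c} - {0})"
    using c by (cases "c = 0") (auto simp: P_def orthogonal_idempotents_def)
  moreover have "\<forall>F. P F \<longrightarrow> card F < Suc DIM('a)"
    using orthogonal_idempotents_card by (auto simp: P_def less_Suc_eq_le)
  ultimately obtain E where E: "P E" and max: "\<And>F. P F \<Longrightarrow> card F \<le> card E"
    using ex_has_greatest_nat[of P "{c} - {0}" card "Suc DIM('a)"] by blast
  have EO: "orthogonal_idempotents E" and fin: "finite E"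
    using E by (auto simp: P_def orthogonal_idempotents_def)
  have "primitive_idempotent (\<circ>\<^sub>J) d" if d: "d \<in> E" for d
  proof (rule ccontr)
    have dI: "idempotent (\<circ>\<^sub>J) d" "d \<noteq> 0" using d EO by (auto simp: orthogonal_idempotents_def)
    assume "\<not> primitive_idempotent (\<circ>\<^sub>J) d"
    then obtain a b where ab: "idempotent (\<circ>\<^sub>J) a" "idempotent (\<circ>\<^sub>J) b" "a \<noteq> 0" "b \<noteq> 0" "d = a + b"
      using dI unfolding primitive_idempotent_def by blast
    have ab0: "a \<circ>\<^sub>J b = 0"
      using sum_of_idempotents_orthogonal ab dI by blast
    define F where "F = E - {d}"
    have F: "a \<circ>\<^sub>J f = 0" "b \<circ>\<^sub>J f = 0" if f: "f \<in> F" for f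
    proof -
      have fI: "idempotent (\<circ>\<^sub>J) f" and df: "d \<circ>\<^sub>J f = 0"
        using f d EO by (auto simp: F_def orthogonal_idempotents_def)
      show "a \<circ>\<^sub>J f = 0"
        using idempotent_summand_orthogonal[OF ab(1,2) fI] df ab(5) by simp
      show "b \<circ>\<^sub>J f = 0"
        using idempotent_summand_orthogonal[OF ab(2,1) fI] df ab(5) by (simp add: add.commute)
    qed
    have F': "f \<circ>\<^sub>J a = 0" "f \<circ>\<^sub>J b = 0" if "f \<in> F" for f
      using F[OF that] commute[of f a] commute[of f b] by simp_all
    have "a \<noteq> b" using ab0 ab(1,3) by (auto simp: idempotent_def)
    moreover have "a \<notin> F" "b \<notin> F" using F ab by (auto simp: idempotent_def)
    moreover have "finite F" using fin by (simp add: F_def)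
    ultimately have "\<Sum>(insert a (insert b F)) = d + \<Sum>F" "card (insert a (insert b F)) = Suc (Suc (card F))"
      using ab(5) by (simp_all add: add.assoc)
    moreover have "d + \<Sum>F = \<Sum>E" "Suc (card F) = card E"
      using sum.remove[OF fin d, of "\<lambda>f. f"] card_Suc_Diff1[OF fin d] unfolding F_def by simp_all
    moreover have "orthogonal_idempotents (insert a (insert b F))"
      using EO ab ab0 commute[of b a] F F' \<open>finite F\<close>
      unfolding orthogonal_idempotents_def F_def by auto
    ultimately have "P (insert a (insert b F))" "card E < card (insert a (insert b F))"
      using E unfolding P_def by auto
    then show False using max by (simp add: leD)
  qed
  then show ?thesis using E unfolding P_def by blast
qed

lemma primitive_idempotent_in_jordan_frame:
  assumes c: "primitive_idempotent (\<circ>\<^sub>J) c"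
  shows "\<exists>E. jordan_frame (\<circ>\<^sub>J) e E \<and> c \<in> E"
proof -
  have cI: "idempotent (\<circ>\<^sub>J) c" "c \<noteq> 0" using c by (auto simp: primitive_idempotent_def)
  obtain E where E: "orthogonal_idempotents E" "\<forall>d\<in>E. primitive_idempotent (\<circ>\<^sub>J) d" "\<Sum>E = e - c"
    using idempotent_primitive_decomposition[OF idempotent_complement[OF cI(1)]] by blast
  have dc: "d \<circ>\<^sub>J c = 0" if d: "d \<in> E" for d
  proof -
    have "d \<in> peirce_one (\<circ>\<^sub>J) (e - c)"
      using orthogonal_idempotents_mult[OF E(1) d, of "\<lambda>_. 1"] E(3) commute[of d "e - c"]
      by (simp add: peirce_one_def)
    then show ?thesis by (simp add: peirce_one_def jp_simps unit_right)
  qed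
  have cd: "c \<circ>\<^sub>J d = 0" if d: "d \<in> E" for d
    using dc[OF d] commute[of c d] by simp
  have "c \<notin> E" using dc cI by (auto simp: idempotent_def)
  then have "jordan_frame (\<circ>\<^sub>J) e (insert c E)"
    using E c dc cd unfolding jordan_frame_def orthogonal_idempotents_def by simp
  then show ?thesis by blast
qed

lemma jordan_frame_exists: "\<exists>E. jordan_frame (\<circ>\<^sub>J) e E"
  using idempotent_primitive_decomposition[OF unit_idempotent]
  unfolding jordan_frame_def orthogonal_idempotents_def by auto

lemma jordan_frame_orthogonal_idempotents:
  "jordan_frame (\<circ>\<^sub>J) e E \<Longrightarrow> orthogonal_idempotents E"
  unfolding jordan_frame_def orthogonal_idempotents_def primitive_idempotent_def by blast

text \<open>
  Idempotency forces the coefficients to be \<open>0\<close> or \<open>1\<close>, so \<open>c\<close> is the sum of a set of frame elements;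
  primitivity allows only one.
\<close>

lemma primitive_idempotent_trace_coeffs:
  assumes c: "primitive_idempotent (\<circ>\<^sub>J) c" and E: "orthogonal_idempotents E"
    and cE: "c = (\<Sum>d\<in>E. l d *\<^sub>R d)"
  shows "sum l E = 1"
proof -
  have cI: "idempotent (\<circ>\<^sub>J) c" "c \<noteq> 0" using c by (auto simp: primitive_idempotent_def)
  have fin: "finite E" using E by (simp add: orthogonal_idempotents_def)
  have l: "l d = 0 \<or> l d = 1" if d: "d \<in> E" for d
  proof -
    have "c = (\<Sum>d\<in>E. (l d)\<^sup>2 *\<^sub>R d)"
      using orthogonal_idempotents_square[OF E, of l] cI(1) cE by (simp add: idempotent_def)
    then have "(l d)\<^sup>2 *\<^sub>R d = l d *\<^sub>R d"
      using orthogonal_idempotents_mult[OF E d, of l]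
        orthogonal_idempotents_mult[OF E d, of "\<lambda>d. (l d)\<^sup>2"] cE by simp
    then show ?thesis using d E by (auto simp: orthogonal_idempotents_def power2_eq_square)
  qed
  define D where "D = {d \<in> E. l d = 1}"
  have D: "orthogonal_idempotents D" "finite D"
    using E by (auto simp: D_def orthogonal_idempotents_def)
  have cD: "c = \<Sum>D"
    unfolding cE by (intro sum.mono_neutral_cong_right fin) (use l in \<open>auto simp: D_def\<close>)
  have lD: "sum l E = sum l D"
    by (intro sum.mono_neutral_right fin) (use l in \<open>auto simp: D_def\<close>)
  have "D \<noteq> {}" using cD cI(2) by auto
  then obtain d where d: "d \<in> D" by blast
  have D': "orthogonal_idempotents (D - {d})" using D by (auto simp: orthogonal_idempotents_def)
  have "c = d + \<Sum>(D - {d})" using cD D(2) d by (simp add: sum.remove)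
  moreover have "idempotent (\<circ>\<^sub>J) (\<Sum>(D - {d}))"
    using orthogonal_idempotents_square[OF D', of "\<lambda>_. 1"] by (simp add: idempotent_def)
  ultimately have zero: "\<Sum>(D - {d}) = 0"
    using c d D(1) unfolding primitive_idempotent_def orthogonal_idempotents_def by blast
  have "D - {d} = {}"
  proof (rule ccontr)
    assume "D - {d} \<noteq> {}"
    then obtain f where f: "f \<in> D - {d}" by blast
    then have "f = 0" using orthogonal_idempotents_mult[OF D' f, of "\<lambda>_. 1"] zero
      by (simp add: jp_simps)
    then show False using f D(1) by (auto simp: orthogonal_idempotents_def)
  qed
  then have "D = {d}" using d by blast
  moreover have "l d = 1" using d by (simp add: D_def)
  ultimately show ?thesis using lD by simp
qed

end

context trace_euclidean_jordan_algebra
begin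

text \<open>
  The trace is read off from some spectral decomposition of \<open>c\<close>. One exists, since \<open>c\<close> belongs to a
  Jordan frame, and all of them give the value one.
\<close>

lemma primitive_idempotent_norm:
  assumes c: "primitive_idempotent (\<circ>\<^sub>J) c"
  shows "inner c c = 1"
proof -
  let ?Q = "\<lambda>t. \<exists>E l. spectral_decomposition (\<circ>\<^sub>J) e c E l \<and> t = (\<Sum>d\<in>E. l d)"
  obtain E where E: "jordan_frame (\<circ>\<^sub>J) e E" "c \<in> E"
    using primitive_idempotent_in_jordan_frame[OF c] by blast
  have "c = (\<Sum>d\<in>E. (if d = c then 1 else 0) *\<^sub>R d)"
    using E by (simp add: jordan_frame_def if_distrib[of "\<lambda>r. r *\<^sub>R _"] cong: if_cong)
  then have "?Q (\<Sum>d\<in>E. if d = c then 1 else 0)"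
    using E(1) unfolding spectral_decomposition_def
    by (intro exI[of _ E] exI[of _ "\<lambda>d. if d = c then 1 else 0"]) simp
  then have "?Q (jordan_trace (\<circ>\<^sub>J) e c)" unfolding jordan_trace_def by (rule someI[of ?Q])
  then obtain E l where "jordan_frame (\<circ>\<^sub>J) e E" "c = (\<Sum>d\<in>E. l d *\<^sub>R d)"
    "jordan_trace (\<circ>\<^sub>J) e c = sum l E"
    unfolding spectral_decomposition_def by blast
  then have "jordan_trace (\<circ>\<^sub>J) e c = 1"
    using primitive_idempotent_trace_coeffs[OF c] jordan_frame_orthogonal_idempotents by metis
  then show ?thesis
    using inner_eq_trace[of c c] c by (simp add: primitive_idempotent_def idempotent_def)
qed

lemma primitive_sum_norm:
  assumes E: "orthogonal_idempotents E" "\<forall>d\<in>E. primitive_idempotent (\<circ>\<^sub>J) d"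
  shows "inner (\<Sum>E) (\<Sum>E) = real (card E)"
proof -
  have fin: "finite E" using E(1) by (simp add: orthogonal_idempotents_def)
  have "inner (\<Sum>E) (\<Sum>E) = (\<Sum>c\<in>E. \<Sum>d\<in>E. inner c d)"
    by (subst inner_sum_left) (simp only: inner_sum_right)
  also have "\<dots> = (\<Sum>c\<in>E. \<Sum>d\<in>E. if d = c then 1 else 0)"
    using orthogonal_idempotents_inner[OF E(1)] E(2) primitive_idempotent_norm
    by (intro sum.cong) auto
  finally show ?thesis using fin by simp
qed

lemma idempotent_norm_nat:
  assumes "idempotent (\<circ>\<^sub>J) c"
  shows "\<exists>m::nat. inner c c = real m"
proof -
  obtain E where E: "orthogonal_idempotents E" "\<forall>d\<in>E. primitive_idempotent (\<circ>\<^sub>J) d" "\<Sum>E = c"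
    using idempotent_primitive_decomposition[OF assms] by blast
  show ?thesis using primitive_sum_norm[OF E(1,2)] E(3) by auto
qed

lemma nonzero_idempotent_norm_ge_one:
  assumes "idempotent (\<circ>\<^sub>J) c" "c \<noteq> 0"
  shows "1 \<le> inner c c"
proof -
  obtain m :: nat where m: "inner c c = real m" using idempotent_norm_nat assms(1) by blast
  have "m \<noteq> 0" using m assms(2) by (intro notI) simp
  then show ?thesis using m by simp
qed

text \<open>
  In particular the cardinality of a Jordan frame does not depend on the frame.
\<close>

lemma jordan_rank_eq_norm_unit: "real (jordan_rank (\<circ>\<^sub>J) e) = inner e e"
proof -
  define E where "E = (SOME E. jordan_frame (\<circ>\<^sub>J) e E)"
  have "jordan_frame (\<circ>\<^sub>J) e E" unfolding E_def by (rule someI_ex[OF jordan_frame_exists])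
  then have "inner (\<Sum>E) (\<Sum>E) = real (card E)" "\<Sum>E = e"
    using primitive_sum_norm jordan_frame_orthogonal_idempotents by (auto simp: jordan_frame_def)
  then show ?thesis by (simp add: jordan_rank_def E_def)
qed

text \<open>
  Let \<open>c\<close> be an idempotent of \<open>F\<close> with largest norm. For \<open>y \<in> F\<close> the support \<open>d\<close> of \<open>c + y\<close> lies in
  \<open>F\<close> and dominates \<open>c\<close>, so \<open>d = c\<close> by maximality; hence \<open>y \<in> V(c,1)\<close>. Conversely, every element of
  \<open>K \<inter> V(c,1)\<close> is dominated by a multiple of \<open>c\<close>, and faces are closed under passing to smaller
  elements of \<open>K\<close>.
\<close>

lemma cone_face_eq_peirce_one:
  assumes F: "cone_face K F"
  shows "\<exists>c\<in>F. idempotent (\<circ>\<^sub>J) c \<and> F = K \<inter> peirce_one (\<circ>\<^sub>J) c"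
proof -
  have cone: "0 \<in> F" "\<And>x y. x \<in> F \<Longrightarrow> y \<in> F \<Longrightarrow> x + y \<in> F"
      "\<And>x t. x \<in> F \<Longrightarrow> 0 \<le> t \<Longrightarrow> t *\<^sub>R x \<in> F"
    using F by (auto simp: cone_face_def convex_cone_iff)
  have FK: "F \<subseteq> K" and face: "\<And>b d. b \<in> K \<Longrightarrow> d \<in> K \<Longrightarrow> b + d \<in> F \<Longrightarrow> b \<in> F"
    using F by (auto simp: cone_face_def)
  have down: "x \<in> F" if "y \<in> F" "x \<in> K" "0 < a" "y - a *\<^sub>R x \<in> K" for x y a
  proof -
    have "a *\<^sub>R x \<in> F"
      using face[of "a *\<^sub>R x" "y - a *\<^sub>R x"] that symmetric_cone_scale by simp
    then have "(1 / a) *\<^sub>R (a *\<^sub>R x) \<in> F" using cone(3)[of "a *\<^sub>R x" "1 / a"] that(3) by simp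
    then show ?thesis using that(3) by simp
  qed
  define P where "P c \<longleftrightarrow> c \<in> F \<and> idempotent (\<circ>\<^sub>J) c" for c
  \<comment> \<open>Squared norms of idempotents are natural numbers; the floor only turns them into type \<open>nat\<close>, so
    that a bounded set of them has a maximum.\<close>
  define N where "N c = nat \<lfloor>inner c c\<rfloor>" for c :: 'a
  have N: "real (N c) = inner c c" if P: "P c" for c
  proof -
    obtain m :: nat where "inner c c = real m" using idempotent_norm_nat[of c] P unfolding P_def by blast
    then show ?thesis by (simp add: N_def)
  qed
  have "N c < Suc (N e)" if "P c" for c
  proof -
    have "inner c c \<le> inner e e"
      using idempotent_norm_mono[of c e] that by (simp add: P_def peirce_one_def unit_right)
    then show ?thesis unfolding N_def by (simp add: less_Suc_eq_le floor_mono nat_mono)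
  qed
  moreover have "P 0" using cone by (simp add: P_def idempotent_def jp_simps)
  ultimately obtain c where c: "P c" and max: "\<And>d. P d \<Longrightarrow> N d \<le> N c"
    using ex_has_greatest_nat[of P 0 N "Suc (N e)"] by blast
  have cF: "c \<in> F" and cI: "idempotent (\<circ>\<^sub>J) c" and cK: "c \<in> K" using c FK by (auto simp: P_def)
  have "y \<in> peirce_one (\<circ>\<^sub>J) c" if y: "y \<in> F" for y
  proof -
    have yK: "y \<in> K" using y FK by blast
    obtain d a b where d: "idempotent (\<circ>\<^sub>J) d" "0 < a" "0 < b"
      "(c + y) - a *\<^sub>R d \<in> K" "b *\<^sub>R d - (c + y) \<in> K"
      using symmetric_cone_support[OF symmetric_cone_add[OF cK yK]] by blast
    have "d \<in> F" using down[of "c + y" d a] cone cF y d idempotent_in_symmetric_cone by blast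
    then have "N d \<le> N c" using max d(1) by (simp add: P_def)
    have "b *\<^sub>R d - 1 *\<^sub>R c \<in> K" "b *\<^sub>R d - 1 *\<^sub>R y \<in> K"
      using symmetric_cone_add[OF d(5) yK] symmetric_cone_add[OF d(5) cK]
      by (simp_all add: algebra_simps)
    then have "c \<in> peirce_one (\<circ>\<^sub>J) d" and yd: "y \<in> peirce_one (\<circ>\<^sub>J) d"
      using dominated_imp_peirce_one[OF d(1)] cK yK zero_less_one by blast+
    then have "inner d d = inner c c + inner (d - c) (d - c)"
      using idempotent_norm_mono cI by blast
    moreover have "inner d d \<le> inner c c"
      using \<open>N d \<le> N c\<close> N[of c] N[of d] c \<open>d \<in> F\<close> d(1) by (simp add: P_def)
    ultimately have "inner (d - c) (d - c) \<le> 0" by simp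
    then show ?thesis using yd by (simp add: dot_square_norm)
  qed
  moreover have "y \<in> F" if y: "y \<in> K" "y \<in> peirce_one (\<circ>\<^sub>J) c" for y
  proof -
    obtain t where "0 < t" "t *\<^sub>R c - 1 *\<^sub>R y \<in> K"
      using peirce_one_imp_dominated[OF cI y] by auto
    then show ?thesis using down[of "t *\<^sub>R c" y 1] cone(3)[OF cF] y(1) by simp
  qed
  ultimately show ?thesis using cF cI FK by blast
qed

end

section \<open>Cone-preserving maps and irreducibility\<close>

locale cone_preserving_map = trace_euclidean_jordan_algebra +
  fixes T
  assumes linear_T: "linear T" and T_cone: "x \<in> K \<Longrightarrow> T x \<in> K"
begin

text \<open>
  Elements of \<open>K \<inter> V(c,1)\<close> are below a multiple of \<open>c\<close>, so their images are below a multiple of \<open>T c\<close>,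
  which is itself below a multiple of \<open>c\<close>. The general case follows because the squares of elements of
  \<open>V(c,1)\<close> span it: \<open>4 x = (x + c)\<^sup>2 - (x - c)\<^sup>2\<close>.
\<close>

lemma T_peirce_one_invariant:
  assumes c: "idempotent (\<circ>\<^sub>J) c" and Tc: "inner (T c) (e - c) = 0"
  shows "T ` peirce_one (\<circ>\<^sub>J) c \<subseteq> peirce_one (\<circ>\<^sub>J) c"
proof -
  have TcK: "T c \<in> K" using c by (intro T_cone idempotent_in_symmetric_cone)
  have Tcc: "T c \<in> peirce_one (\<circ>\<^sub>J) c" using symmetric_cone_peirce_one_iff[OF TcK c] Tc by blast
  then obtain s where s: "0 < s" "s *\<^sub>R c - T c \<in> K"
    using peirce_one_imp_dominated[OF c TcK] by blast
  have cone: "T x \<in> peirce_one (\<circ>\<^sub>J) c" if x: "x \<in> K \<inter> peirce_one (\<circ>\<^sub>J) c" for x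
  proof -
    obtain t where t: "0 < t" "t *\<^sub>R c - x \<in> K"
      using peirce_one_imp_dominated[OF c] x by blast
    have "T (t *\<^sub>R c - x) + t *\<^sub>R (s *\<^sub>R c - T c) \<in> K"
      using T_cone[OF t(2)] symmetric_cone_scale[OF s(2), of t] t(1)
      by (intro symmetric_cone_add) auto
    then have "(t * s) *\<^sub>R c - 1 *\<^sub>R T x \<in> K"
      by (simp add: linear_diff[OF linear_T] linear_scale[OF linear_T] scaleR_diff_right)
    then show ?thesis using x T_cone by (intro dominated_imp_peirce_one[OF c, of "T x" 1]) auto
  qed
  show ?thesis
  proof
    fix y assume "y \<in> T ` peirce_one (\<circ>\<^sub>J) c"
    then obtain x where x: "x \<in> peirce_one (\<circ>\<^sub>J) c" "y = T x" by blast
    let ?p = "(x + c) \<circ>\<^sub>J (x + c)" and ?q = "(x - c) \<circ>\<^sub>J (x - c)"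
    have "x \<circ>\<^sub>J c = x" using x(1) by (simp add: peirce_one_def)
    then have "?p - ?q = 4 *\<^sub>R x"
      using commute[of c x] c scaleR_left_distrib[of 2 2 x]
      by (simp add: jp_simps idempotent_def scaleR_2 algebra_simps)
    then have "x = (1 / 4) *\<^sub>R (?p - ?q)" by simp
    then have "y = (1 / 4) *\<^sub>R (T ?p - T ?q)"
      using x(2) by (metis linear_diff linear_scale linear_T)
    moreover have "x + c \<in> peirce_one (\<circ>\<^sub>J) c" "x - c \<in> peirce_one (\<circ>\<^sub>J) c"
      using x(1) idempotent_mem_peirce_one[OF c] subspace_peirce_one
      by (auto intro: subspace_add subspace_diff)
    then have "T ?p \<in> peirce_one (\<circ>\<^sub>J) c" "T ?q \<in> peirce_one (\<circ>\<^sub>J) c"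
      using cone peirce_one_square[OF c] by blast+
    ultimately show "y \<in> peirce_one (\<circ>\<^sub>J) c"
      using subspace_peirce_one by (simp add: subspace_diff subspace_scale)
  qed
qed

lemma T_face_invariant_imp_inner_zero:
  assumes c: "idempotent (\<circ>\<^sub>J) c"
    and inv: "T ` (K \<inter> peirce_one (\<circ>\<^sub>J) c) \<subseteq> peirce_one (\<circ>\<^sub>J) c"
  shows "inner (T c) (e - c) = 0"
proof -
  have cK: "c \<in> K" using c by (rule idempotent_in_symmetric_cone)
  have "T c \<in> peirce_one (\<circ>\<^sub>J) c" using inv cK idempotent_mem_peirce_one[OF c] by blast
  then show ?thesis using symmetric_cone_peirce_one_iff[OF T_cone[OF cK] c] by blast
qed

definition idempotent_irreducible :: bool where
  "idempotent_irreducible \<longleftrightarrow>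
     (\<forall>c. idempotent (\<circ>\<^sub>J) c \<longrightarrow> inner (T c) (e - c) = 0 \<longrightarrow> c = 0 \<or> c = e)"

lemma idempotent_irreducible_iff_space_irreducible:
  "idempotent_irreducible \<longleftrightarrow> space_irreducible (\<circ>\<^sub>J) e T"
  using T_peirce_one_invariant T_face_invariant_imp_inner_zero
  unfolding idempotent_irreducible_def space_irreducible_def by blast

lemma idempotent_irreducible_iff_cone_irreducible:
  "idempotent_irreducible \<longleftrightarrow> cone_irreducible K T"
proof
  assume irr: "idempotent_irreducible"
  show "cone_irreducible K T"
    unfolding cone_irreducible_def
  proof (intro allI impI)
    fix F assume F: "cone_face K F \<and> T ` F \<subseteq> F"
    then obtain c where c: "idempotent (\<circ>\<^sub>J) c" "F = K \<inter> peirce_one (\<circ>\<^sub>J) c"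
      using cone_face_eq_peirce_one by blast
    then have "c = 0 \<or> c = e"
      using irr T_face_invariant_imp_inner_zero F unfolding idempotent_irreducible_def by blast
    then show "F = {0} \<or> F = K"
      using c(2) symmetric_cone_zero by (auto simp: peirce_one_def jp_simps unit_right)
  qed
next
  assume irr: "cone_irreducible K T"
  show "idempotent_irreducible"
    unfolding idempotent_irreducible_def
  proof (intro allI impI)
    fix c assume c: "idempotent (\<circ>\<^sub>J) c" and "inner (T c) (e - c) = 0"
    then have "T ` (K \<inter> peirce_one (\<circ>\<^sub>J) c) \<subseteq> K \<inter> peirce_one (\<circ>\<^sub>J) c"
      using T_peirce_one_invariant T_cone by blast
    then have F: "K \<inter> peirce_one (\<circ>\<^sub>J) c = {0} \<or> K \<inter> peirce_one (\<circ>\<^sub>J) c = K"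
      using irr cone_face_peirce_one[OF c] unfolding cone_irreducible_def by blast
    have "c \<in> K \<inter> peirce_one (\<circ>\<^sub>J) c" "e \<in> K"
      using c unit_idempotent
      by (auto intro: idempotent_in_symmetric_cone idempotent_mem_peirce_one)
    then show "c = 0 \<or> c = e" using F idempotent_mem_peirce_one_unit by blast
  qed
qed

section \<open>Positivity of the powers\<close>

abbreviation shifted_iterate :: "nat \<Rightarrow> 'a \<Rightarrow> 'a" where
  "shifted_iterate k \<equiv> (\<lambda>y. y + T y) ^^ k"

lemma shifted_iterate_cone: "x \<in> K \<Longrightarrow> shifted_iterate k x \<in> K"
  by (induction k) (auto intro: symmetric_cone_add T_cone)

lemma linear_shifted_iterate: "linear (shifted_iterate k)"
proof (induction k)
  case (Suc k)
  have step: "linear (\<lambda>y. y + T y)" by (intro linear_compose_add linear_ident linear_T)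
  show ?case using linear_compose[OF Suc step] by (simp add: comp_def)
qed (simp add: linear_ident)

text \<open>
  With \<open>y = (I + T)\<^sup>k x\<close>, both \<open>y\<close> and \<open>T y\<close> are below \<open>y + T y\<close>. Hence the new support \<open>d\<close> dominates
  the old support \<open>c\<close> and also a multiple of \<open>T c\<close>. If \<open>d = c\<close>, this gives \<open>\<langle>T c, e - c\<rangle> = 0\<close>, so
  \<open>c = e\<close>; otherwise \<open>d - c\<close> is a nonzero idempotent and adds at least one to the squared norm.
\<close>

lemma shifted_iterate_support_growth:
  assumes irr: "idempotent_irreducible" and x: "x \<in> K" "x \<noteq> 0"
  shows "\<exists>c a. idempotent (\<circ>\<^sub>J) c \<and> 0 < a \<and> shifted_iterate k x - a *\<^sub>R c \<in> K \<and>
    (\<exists>b. b *\<^sub>R c - shifted_iterate k x \<in> K) \<and> (real (k + 1) \<le> inner c c \<or> c = e)"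
proof (induction k)
  case 0
  obtain c a b where c: "idempotent (\<circ>\<^sub>J) c" "0 < a" "0 < b" "x - a *\<^sub>R c \<in> K" "b *\<^sub>R c - x \<in> K"
    using symmetric_cone_support[OF x(1)] by blast
  have "c \<noteq> 0" using c(5) x symmetric_cone_pointed by auto
  then have "1 \<le> inner c c" using c(1) nonzero_idempotent_norm_ge_one by blast
  then show ?case using c by auto
next
  case (Suc k)
  define y where "y = shifted_iterate k x"
  have yK: "y \<in> K" unfolding y_def using x(1) by (rule shifted_iterate_cone)
  obtain c a where c: "idempotent (\<circ>\<^sub>J) c" "0 < a" "y - a *\<^sub>R c \<in> K"
    and big: "real (k + 1) \<le> inner c c \<or> c = e"
    using Suc.IH unfolding y_def by blast
  have cK: "c \<in> K" using c(1) by (rule idempotent_in_symmetric_cone)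
  obtain d a' b where d: "idempotent (\<circ>\<^sub>J) d" "0 < a'" "0 < b"
    "(y + T y) - a' *\<^sub>R d \<in> K" "b *\<^sub>R d - (y + T y) \<in> K"
    using symmetric_cone_support[OF symmetric_cone_add[OF yK T_cone[OF yK]]] by blast
  have "(b *\<^sub>R d - (y + T y)) + T y + (y - a *\<^sub>R c) \<in> K"
    using d(5) T_cone[OF yK] c(3) by (intro symmetric_cone_add)
  then have cd: "c \<in> peirce_one (\<circ>\<^sub>J) d"
    using cK c(2) by (intro dominated_imp_peirce_one[OF d(1), of c a b]) auto
  have "(b *\<^sub>R d - (y + T y)) + y + T (y - a *\<^sub>R c) \<in> K"
    using d(5) yK T_cone[OF c(3)] by (intro symmetric_cone_add)
  then have Tcd: "T c \<in> peirce_one (\<circ>\<^sub>J) d"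
    using T_cone[OF cK] c(2)
    by (intro dominated_imp_peirce_one[OF d(1), of "T c" a b])
      (auto simp: linear_diff[OF linear_T] linear_scale[OF linear_T])
  have norm: "inner d d = inner c c + inner (d - c) (d - c)"
    by (rule idempotent_norm_mono[OF c(1) cd])
  have "real (Suc k + 1) \<le> inner d d \<or> d = e"
  proof (cases "c = e")
    case True
    then show ?thesis using cd idempotent_mem_peirce_one_unit by blast
  next
    case ce: False
    then have big: "real (k + 1) \<le> inner c c" using big by blast
    show ?thesis
    proof (cases "d = c")
      case True
      then have "inner (T c) (e - c) = 0"
        using Tcd symmetric_cone_peirce_one_iff[OF T_cone[OF cK] c(1)] by blast
      then have "c = 0" using irr c(1) ce unfolding idempotent_irreducible_def by blast
      then show ?thesis using big by simp
    next
      case False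
      have "idempotent (\<circ>\<^sub>J) (d - c)"
        using cd c(1) d(1) by (intro idempotent_diff) (auto simp: peirce_one_def)
      then have "1 \<le> inner (d - c) (d - c)"
        using False nonzero_idempotent_norm_ge_one by auto
      then show ?thesis using norm big by simp
    qed
  qed
  then show ?case using d unfolding y_def by auto
qed

lemma idempotent_irreducible_imp_power_positive:
  assumes irr: "idempotent_irreducible" and x: "x \<in> K" "x \<noteq> 0"
  shows "shifted_iterate (jordan_rank (\<circ>\<^sub>J) e - 1) x \<in> interior K"
proof -
  let ?n = "jordan_rank (\<circ>\<^sub>J) e"
  have "real ?n > 0" using jordan_rank_eq_norm_unit unit_nonzero by simp
  then have "?n - 1 + 1 = ?n" by linarith
  then have n: "real (?n - 1 + 1) = inner e e" by (simp only: jordan_rank_eq_norm_unit)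
  obtain c a where c: "idempotent (\<circ>\<^sub>J) c" "0 < a" "shifted_iterate (?n - 1) x - a *\<^sub>R c \<in> K"
    "real (?n - 1 + 1) \<le> inner c c \<or> c = e"
    using shifted_iterate_support_growth[OF irr x] by blast
  have "inner e e = inner c c + inner (e - c) (e - c)"
    using idempotent_norm_mono[OF c(1), of e] by (simp add: peirce_one_def unit_right)
  then have "c = e" using c(4) n by (auto simp: dot_square_norm)
  then show ?thesis using c interior_symmetric_cone_iff by blast
qed

text \<open>
  \<open>(I + T)\<^sup>m x\<close> is a combination of the \<open>T\<^sup>k x\<close>; generalising from \<open>x\<close> to all \<open>T\<^sup>k x\<close> makes the
  induction on \<open>m\<close> go through without binomial coefficients.
\<close>

lemma shifted_iterate_peirce_one:
  assumes "\<And>k. (T ^^ k) x \<in> peirce_one (\<circ>\<^sub>J) c"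
  shows "shifted_iterate m x \<in> peirce_one (\<circ>\<^sub>J) c"
proof -
  have "shifted_iterate m ((T ^^ k) x) \<in> peirce_one (\<circ>\<^sub>J) c" for k
  proof (induction m arbitrary: k)
    case 0 then show ?case using assms by simp
  next
    case (Suc m)
    have "shifted_iterate (Suc m) ((T ^^ k) x) = shifted_iterate m ((T ^^ k) x + (T ^^ Suc k) x)"
      by (simp only: funpow_Suc_right[of m] funpow.simps(2)[of k T] comp_apply)
    also have "\<dots> = shifted_iterate m ((T ^^ k) x) + shifted_iterate m ((T ^^ Suc k) x)"
      by (rule linear_add[OF linear_shifted_iterate])
    finally have "shifted_iterate (Suc m) ((T ^^ k) x)
        = shifted_iterate m ((T ^^ k) x) + shifted_iterate m ((T ^^ Suc k) x)" .
    then show ?case using Suc.IH[of k] Suc.IH[of "Suc k"] subspace_peirce_one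
      by (simp add: subspace_add del: funpow.simps(2))
  qed
  from this[of 0] show ?thesis by simp
qed

lemma T_iterate_peirce_one:
  assumes c: "idempotent (\<circ>\<^sub>J) c" and Tc: "inner (T c) (e - c) = 0"
  shows "(T ^^ k) c \<in> peirce_one (\<circ>\<^sub>J) c"
  using T_peirce_one_invariant[OF c Tc] idempotent_mem_peirce_one[OF c] by (induction k) auto

lemma power_positive_imp_idempotent_irreducible:
  assumes pos: "\<And>x. x \<in> K \<Longrightarrow> x \<noteq> 0 \<Longrightarrow> shifted_iterate m x \<in> interior K"
  shows "idempotent_irreducible"
  unfolding idempotent_irreducible_def
proof (intro allI impI)
  fix c assume c: "idempotent (\<circ>\<^sub>J) c" and Tc: "inner (T c) (e - c) = 0"
  have "shifted_iterate m c \<in> peirce_one (\<circ>\<^sub>J) c"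
    by (intro shifted_iterate_peirce_one T_iterate_peirce_one c Tc)
  then show "c = 0 \<or> c = e"
    using pos[of c] interior_peirce_one_imp_unit[OF c] idempotent_in_symmetric_cone[OF c] by blast
qed

section \<open>Positivity of the exponential\<close>

lemma exp_map_sums: "(\<lambda>k. (t ^ k / fact k) *\<^sub>R (T ^^ k) x) sums exp_map (\<lambda>y. t *\<^sub>R T y) x"
proof -
  obtain B where B: "0 < B" "\<And>y. norm (T y) \<le> B * norm y"
    using linear_bounded_pos[OF linear_T] by blast
  have normT: "norm ((T ^^ k) x) \<le> B ^ k * norm x" for k
  proof (induction k)
    case (Suc k)
    have "norm ((T ^^ Suc k) x) \<le> B * norm ((T ^^ k) x)" using B(2) by simp
    also have "\<dots> \<le> B * (B ^ k * norm x)" using Suc B(1) by (intro mult_left_mono) auto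
    finally show ?case by simp
  qed simp
  have "summable (\<lambda>k. (t ^ k / fact k) *\<^sub>R (T ^^ k) x)"
  proof (rule summable_comparison_test)
    show "summable (\<lambda>k. inverse (fact k) * (\<bar>t\<bar> * B) ^ k * norm x)"
      by (intro summable_mult2 summable_exp)
    have "norm ((t ^ k / fact k) *\<^sub>R (T ^^ k) x) \<le> inverse (fact k) * (\<bar>t\<bar> * B) ^ k * norm x" for k
    proof -
      have "norm ((t ^ k / fact k) *\<^sub>R (T ^^ k) x) = (\<bar>t\<bar> ^ k / fact k) * norm ((T ^^ k) x)"
        by (simp add: power_abs)
      also have "\<dots> \<le> (\<bar>t\<bar> ^ k / fact k) * (B ^ k * norm x)"
        by (intro mult_left_mono normT) simp
      finally show ?thesis by (simp add: power_mult_distrib field_simps)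
    qed
    then show "\<exists>N. \<forall>k\<ge>N. norm ((t ^ k / fact k) *\<^sub>R (T ^^ k) x)
        \<le> inverse (fact k) * (\<bar>t\<bar> * B) ^ k * norm x" by blast
  qed
  moreover have "((\<lambda>y. t *\<^sub>R T y) ^^ k) x = t ^ k *\<^sub>R (T ^^ k) x" for k
    by (induction k) (simp_all add: linear_scale[OF linear_T])
  ultimately show ?thesis
    unfolding exp_map_def by (simp add: summable_sums_iff divide_inverse mult.commute)
qed

lemma sums_in_closed_cone:
  assumes f: "f sums s" and "\<And>k. f k \<in> S" and S: "closed S" "0 \<in> S" "\<And>x y. x \<in> S \<Longrightarrow> y \<in> S \<Longrightarrow> x + y \<in> S"
  shows "s \<in> S"
proof (rule Lim_in_closed_set[OF S(1)])
  have "(\<Sum>k<n. f k) \<in> S" for n using assms(2) S(2,3) by (induction n) auto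
  then show "\<forall>\<^sub>F n in sequentially. (\<Sum>k<n. f k) \<in> S" by simp
  show "(\<lambda>n. \<Sum>k<n. f k) \<longlonglongrightarrow> s" using f by (simp add: sums_def)
qed simp

lemma T_iterate_cone: "x \<in> K \<Longrightarrow> (T ^^ k) x \<in> K"
  by (induction k) (auto intro: T_cone)

text \<open>
  Let \<open>c\<close> be the support of the exponential \<open>u\<close>. The series of the numbers \<open>\<langle>t\<^sup>k T\<^sup>k x / k!, e - c\<rangle>\<close>
  has nonnegative terms and sum \<open>\<langle>u, e - c\<rangle> = 0\<close>, so every \<open>T\<^sup>k x\<close> lies in \<open>V(c,1)\<close>.
\<close>

lemma power_positive_imp_exp_positive:
  assumes pos: "shifted_iterate m x \<in> interior K" and x: "x \<in> K" and t: "0 < t"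
  shows "exp_map (\<lambda>y. t *\<^sub>R T y) x \<in> interior K"
proof -
  define u where "u = exp_map (\<lambda>y. t *\<^sub>R T y) x"
  define f where "f k = (t ^ k / fact k) *\<^sub>R (T ^^ k) x" for k
  have sums: "f sums u" unfolding u_def f_def by (rule exp_map_sums)
  have fK: "f k \<in> K" for k
    unfolding f_def using t by (intro symmetric_cone_scale T_iterate_cone x) simp
  have uK: "u \<in> K"
    by (rule sums_in_closed_cone[OF sums fK closed_symmetric_cone symmetric_cone_zero symmetric_cone_add])
  obtain c a b where c: "idempotent (\<circ>\<^sub>J) c" "0 < a" "0 < b" "u - a *\<^sub>R c \<in> K" "b *\<^sub>R c - u \<in> K"
    using symmetric_cone_support[OF uK] by blast
  have compl: "e - c \<in> K" by (rule idempotent_in_symmetric_cone[OF idempotent_complement[OF c(1)]])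
  have "u \<in> peirce_one (\<circ>\<^sub>J) c"
    using dominated_imp_peirce_one[OF c(1) uK zero_less_one] c(5) by simp
  then have "inner u (e - c) = 0" using symmetric_cone_peirce_one_iff uK c(1) by blast
  moreover have "(\<lambda>k. inner (f k) (e - c)) sums inner u (e - c)"
    by (rule bounded_linear.sums[OF bounded_linear_inner_left sums])
  moreover have "0 \<le> inner (f k) (e - c)" for k
    by (rule symmetric_cone_inner_nonneg[OF fK compl])
  ultimately have "inner (f k) (e - c) = 0" for k
    using suminf_eq_zero_iff[of "\<lambda>k. inner (f k) (e - c)"] by (auto simp: sums_iff)
  then have "inner ((T ^^ k) x) (e - c) = 0" for k
    using t unfolding f_def by (auto dest: spec[of _ k])
  then have "(T ^^ k) x \<in> peirce_one (\<circ>\<^sub>J) c" for k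
    using symmetric_cone_peirce_one_iff[OF T_iterate_cone[OF x] c(1)] by blast
  then have "c = e"
    by (intro interior_peirce_one_imp_unit[OF c(1) pos] shifted_iterate_peirce_one)
  then show ?thesis using c(2,4) interior_symmetric_cone_iff unfolding u_def by blast
qed

text \<open>
  An invariant \<open>V(c,1)\<close> is closed, hence contains \<open>exp(t T) c\<close>.
\<close>

lemma exp_positive_imp_idempotent_irreducible:
  assumes pos: "\<And>x. x \<in> K \<Longrightarrow> x \<noteq> 0 \<Longrightarrow> exp_map (\<lambda>y. t *\<^sub>R T y) x \<in> interior K"
  shows "idempotent_irreducible"
  unfolding idempotent_irreducible_def
proof (intro allI impI)
  fix c assume c: "idempotent (\<circ>\<^sub>J) c" and Tc: "inner (T c) (e - c) = 0"
  have sub: "subspace (peirce_one (\<circ>\<^sub>J) c)" by (rule subspace_peirce_one)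
  have "exp_map (\<lambda>y. t *\<^sub>R T y) c \<in> peirce_one (\<circ>\<^sub>J) c"
    by (rule sums_in_closed_cone[OF exp_map_sums])
      (auto intro: subspace_scale[OF sub] T_iterate_peirce_one[OF c Tc] closed_subspace[OF sub]
        subspace_0[OF sub] subspace_add[OF sub])
  then show "c = 0 \<or> c = e"
    using pos[of c] interior_peirce_one_imp_unit[OF c] idempotent_in_symmetric_cone[OF c] by blast
qed

end

theorem theorem4p7:
  fixes jp :: "'a::euclidean_space \<Rightarrow> 'a \<Rightarrow> 'a"
    and e :: 'a
    and T :: "'a \<Rightarrow> 'a"
  assumes "trace_euclidean_jordan_algebra jp e"
    and "linear T"
    and "T ` symmetric_cone jp \<subseteq> symmetric_cone jp"
  shows "((\<forall>c. idempotent jp c \<longrightarrow> inner (T c) (e - c) = 0 \<longrightarrow> c = 0 \<or> c = e)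
            \<longleftrightarrow> space_irreducible jp e T) \<and>
         (space_irreducible jp e T
            \<longleftrightarrow> cone_irreducible (symmetric_cone jp) T) \<and>
         (cone_irreducible (symmetric_cone jp) T
            \<longleftrightarrow> (\<forall>x\<in>symmetric_cone jp. x \<noteq> 0 \<longrightarrow>
                  ((\<lambda>y. y + T y) ^^ (jordan_rank jp e - 1)) x \<in> interior (symmetric_cone jp))) \<and>
         ((\<forall>x\<in>symmetric_cone jp. x \<noteq> 0 \<longrightarrow>
                  ((\<lambda>y. y + T y) ^^ (jordan_rank jp e - 1)) x \<in> interior (symmetric_cone jp))
            \<longleftrightarrow> (\<forall>x\<in>symmetric_cone jp. x \<noteq> 0 \<longrightarrow>
                  (\<forall>t>0. exp_map (\<lambda>y. t *\<^sub>R T y) x \<in> interior (symmetric_cone jp))))"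
proof -
  interpret trace_euclidean_jordan_algebra jp e by (rule assms(1))
  interpret cone_preserving_map jp e T
    by (intro cone_preserving_map.intro cone_preserving_map_axioms.intro)
      (use assms in auto)
  let ?i = "idempotent_irreducible"
  have iv: "?i \<longleftrightarrow> (\<forall>x\<in>symmetric_cone jp. x \<noteq> 0 \<longrightarrow>
      ((\<lambda>y. y + T y) ^^ (jordan_rank jp e - 1)) x \<in> interior (symmetric_cone jp))"
    using idempotent_irreducible_imp_power_positive power_positive_imp_idempotent_irreducible
    by blast
  have "?i \<longleftrightarrow> (\<forall>x\<in>symmetric_cone jp. x \<noteq> 0 \<longrightarrow>
      (\<forall>t>0. exp_map (\<lambda>y. t *\<^sub>R T y) x \<in> interior (symmetric_cone jp)))"
    using iv power_positive_imp_exp_positive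
      exp_positive_imp_idempotent_irreducible[of 1] zero_less_one[where 'a = real] by blast
  with iv show ?thesis
    using idempotent_irreducible_iff_space_irreducible idempotent_irreducible_iff_cone_irreducible
    unfolding idempotent_irreducible_def by argo
qed

end
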